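(* Let $x,y$ be nonnegative integers, $k$ an integer, and $W\subseteq[x+y]=\{1,\dots,x+y\}$. Then $S_{x,y}(\overline W)$ has no lozenge tiling unless $|W|=y$, and if $|W|=y$, \[\operatorname{M}_{(q,X,Y,k)}(S_{x,y}(\overline{W}))=\frac{\Delta_{1,1,(q,X,Y,k)}(W)}{\prod_{i=1}^{y-1}\langle i\rangle_{q}!},\] where $\Delta_{1,1,(q,X,Y,k)}(W)=\prod_{w_1,w_2\in W,\,w_1<w_2}\left[\frac{q^{(w_1+w_2+k)-(x+y+1)}X+q^{-((w_1+w_2+k)-(x+y+1))}Y}{2}\right]\langle w_2-w_1\rangle_q$.
   Context: Triangular lattice of unit triangles (side $1$) with one family of lattice lines vertical; left-pointing unit triangles have a vertical side on their right. A lozenge is a union of two unit triangles sharing an edge; horizontal if the shared edge is vertical. $S_{x,y}$ is the trapezoid whose sides, clockwise from the vertical left side, have lengths $x$, $y$, $x+y$, $y$; label the unit segments of its right side $-\frac{x+y-1}{2},\dots,\frac{x+y-1}{2}$ from bottom to top. $S_{x,y}(\overline W)$ is obtained by deleting the left-pointing unit triangles whose right sides are the right-boundary segments labeled by elements of $W-\frac{x+y+1}{2}=\{w-\frac{x+y+1}{2}:w\in W\}$ (i.e. the $w$-th segments from the bottom, $w\in W$). Weights: define the $i$-coordinate of a point as $k$ plus twice its signed vertical distance above the perpendicular bisector of the left side (so that bisector is the line $i=k$); a horizontal lozenge whose center has $i$-coordinate $n$ gets weight $\frac{Xq^n+Yq^{-n}}{2}$, all other lozenges weight $1$; $\operatorname{M}_{(q,X,Y,k)}$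 is the sum over lozenge tilings of the product of weights. $\langle n\rangle_q=\frac{q^n-q^{-n}}{q-q^{-1}}$, $\langle n\rangle_q!=\langle1\rangle_q\cdots\langle n\rangle_q$. *)

theory Defs
  imports Complex_Main "HOL-Library.Disjoint_Sets"
begin

text \<open>
  The lattice point \<open>(c, r)\<close> stands for the point of the plane at horizontal distance
  \<open>c * sqrt 3 / 2\<close> to the right of the left side of the trapezoid and at height \<open>r - c / 2\<close> above
  the lower end of that side. So \<open>c\<close> numbers the vertical lattice lines, and the edges of the
  lattice join \<open>(c, r)\<close> to \<open>(c, r + 1)\<close>, \<open>(c + 1, r)\<close> and \<open>(c + 1, r + 1)\<close>.

  Each unit triangle has exactly one vertical side. Both \<open>Left_Tri c r\<close> and \<open>Right_Tri c r\<close> have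
  the vertical side from \<open>(c, r)\<close> to \<open>(c, r + 1)\<close>; it is the right side of the left-pointing
  triangle and the left side of the right-pointing one.
\<close>

type_synonym point = "int \<times> int"

datatype triangle = Left_Tri int int | Right_Tri int int

fun vertices :: "triangle \<Rightarrow> point set" where
  "vertices (Left_Tri c r) = {(c, r), (c, r + 1), (c - 1, r)}"
| "vertices (Right_Tri c r) = {(c, r), (c, r + 1), (c + 1, r + 1)}"

text \<open>
  A lozenge is represented by the set of its two unit triangles. Distinct unit triangles share an
  edge iff they have two common vertices, which are then the ends of the edge.
\<close>

definition lozenges :: "triangle set set" where
  "lozenges = {{s, t} | s t. s \<noteq> t \<and> card (vertices s \<inter> vertices t) = 2}"

definition shared_edge :: "triangle set \<Rightarrow> point set" where
  "shared_edge l = (\<Inter>t\<in>l. vertices t)"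

definition horizontal :: "triangle set \<Rightarrow> bool" where
  "horizontal l \<longleftrightarrow> (\<exists>c. \<forall>p\<in>shared_edge l. fst p = c)"

text \<open>
  The corners of \<open>S\<^sub>x\<^sub>,\<^sub>y\<close> are \<open>(0, 0)\<close>, \<open>(0, x)\<close>, \<open>(y, x + y)\<close>, \<open>(y, 0)\<close>, clockwise from the lower
  left one. As the trapezoid is convex, it contains a triangle iff it contains its vertices.
\<close>

definition trapezoid :: "nat \<Rightarrow> nat \<Rightarrow> triangle set" where
  "trapezoid x y =
     {t. \<forall>(c, r)\<in>vertices t. 0 \<le> c \<and> c \<le> int y \<and> 0 \<le> r \<and> r \<le> int x + c}"

text \<open>The \<open>w\<close>-th unit segment of the right side, counted from the bottom, ends at \<open>(y, w)\<close>.\<close>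

definition dents :: "nat \<Rightarrow> nat set \<Rightarrow> triangle set" where
  "dents y W = (\<lambda>w. Left_Tri (int y) (int w - 1)) ` W"

text \<open>
  The inclusion of the deleted triangles in the trapezoid is automatic if \<open>y > 0\<close> and \<open>W\<close> is a
  subset of \<open>{1..x + y}\<close>. For \<open>y = 0\<close> the trapezoid is a segment and contains no triangle, so the
  inclusion means that \<open>W\<close> is empty.
\<close>

definition tilings :: "nat \<Rightarrow> nat \<Rightarrow> nat set \<Rightarrow> triangle set set set" where
  "tilings x y W =
     {T. T \<subseteq> lozenges \<and> dents y W \<subseteq> trapezoid x y \<and>
         partition_on (trapezoid x y - dents y W) T}"

text \<open>
  The perpendicular bisector of the left side is at height \<open>x / 2\<close>, so the signed distance of
  \<open>(c, r)\<close> above it is \<open>r - c / 2 - x / 2\<close>.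
\<close>

definition i_coord :: "nat \<Rightarrow> int \<Rightarrow> point \<Rightarrow> int" where
  "i_coord x k p = k + (2 * snd p - fst p - int x)"

text \<open>
  The center of a lozenge is the midpoint of its shared edge, and the \<open>i\<close>-coordinate is affine. For
  horizontal lozenges the two summands differ by 2, so the division is exact.
\<close>

definition center_i_coord :: "nat \<Rightarrow> int \<Rightarrow> triangle set \<Rightarrow> int" where
  "center_i_coord x k l = (\<Sum>p\<in>shared_edge l. i_coord x k p) div 2"

definition wt :: "'a::field \<Rightarrow> 'a \<Rightarrow> 'a \<Rightarrow> int \<Rightarrow> 'a" where
  "wt q X Y n = (X * q powi n + Y * q powi (- n)) / 2"

definition lozenge_weight ::
    "nat \<Rightarrow> 'a::field \<Rightarrow> 'a \<Rightarrow> 'a \<Rightarrow> int \<Rightarrow> triangle set \<Rightarrow> 'a" where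
  "lozenge_weight x q X Y k l =
     (if horizontal l then wt q X Y (center_i_coord x k l) else 1)"

definition tiling_sum ::
    "nat \<Rightarrow> nat \<Rightarrow> nat set \<Rightarrow> 'a::field \<Rightarrow> 'a \<Rightarrow> 'a \<Rightarrow> int \<Rightarrow> 'a" where
  "tiling_sum x y W q X Y k =
     (\<Sum>T\<in>tilings x y W. \<Prod>l\<in>T. lozenge_weight x q X Y k l)"

definition q_bracket :: "'a::field \<Rightarrow> int \<Rightarrow> 'a" where
  "q_bracket q n = (q powi n - q powi (- n)) / (q - inverse q)"

definition q_fact :: "'a::field \<Rightarrow> nat \<Rightarrow> 'a" where
  "q_fact q n = (\<Prod>i=1..n. q_bracket q (int i))"

definition Delta11 ::
    "nat \<Rightarrow> nat \<Rightarrow> 'a::field \<Rightarrow> 'a \<Rightarrow> 'a \<Rightarrow> int \<Rightarrow> nat set \<Rightarrow> 'a" where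
  "Delta11 x y q X Y k W =
     (\<Prod>(w1, w2)\<in>{(w1, w2). w1 \<in> W \<and> w2 \<in> W \<and> w1 < w2}.
        wt q X Y ((int w1 + int w2 + k) - (int x + int y + 1)) * q_bracket q (int w2 - int w1))"

end

theory Submission
  imports Defs "HOL-Library.Infinite_Set" "HOL-Library.FuncSet" "Jordan_Normal_Form.Determinant"
begin

text \<open>
  Cut the tiling along the last vertical lattice line before the right side. If \<open>V\<close> labels the
  horizontal lozenges centred on that line, then the part to the left is a tiling of the smaller
  trapezoid with dents \<open>V\<close>, whereas the triangles of the last strip form a path in the dual graph, so
  that what remains of it has at most one tiling, and has one iff \<open>V\<close> interlaces \<open>W\<close>. This gives
  a recursion for the tiling sum.

  With \<open>f m = X q\<^sup>m - Y q\<^sup>-\<^sup>m\<close> each factor of the claimed product is a difference of values of \<open>f\<close>, so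
  the product is a Vandermonde determinant up to a power of \<open>2 (q - 1/q)\<close>. The weight of a lozenge is a
  multiple of \<open>f (m + 1) - f (m - 1)\<close>, and \<open>(f (m + 1)\<^sup>j - f (m - 1)\<^sup>j) / (f (m + 1) - f (m - 1))\<close> is
  a polynomial in \<open>f m\<close> of degree \<open>j - 1\<close> whose leading coefficient is the \<open>q\<close>-integer \<open>j\<close>. Choosing these
  polynomials as the columns of the Vandermonde determinant, the sum over interlacing \<open>V\<close>
  telescopes row by row.
\<close>

section \<open>Perfect matchings of a path\<close>

text \<open>
  In a perfect matching of \<open>S\<close> by pairs of consecutive numbers, matching greedily from below is
  forced; \<open>matched_back S i\<close> says that \<open>i\<close> is then due to be matched with \<open>i - 1\<close>.
\<close>

primrec matched_back :: "nat set \<Rightarrow> nat \<Rightarrow> bool" where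
  "matched_back S 0 = False"
| "matched_back S (Suc i) \<longleftrightarrow> i \<in> S \<and> \<not> matched_back S i"

definition path_matching :: "nat set \<Rightarrow> nat set set" where
  "path_matching S = (\<lambda>i. {i, Suc i}) ` {i \<in> S. \<not> matched_back S i}"

text \<open>The smallest number of \<open>S\<close> can only be matched upwards; by induction, the
  pair of each number is determined by what happened below it.\<close>

lemma path_matching_unique:
  assumes P: "partition_on S P" and edges: "P \<subseteq> range (\<lambda>i. {i, Suc i})"
  shows "P = path_matching S" and "\<forall>i. matched_back S i \<longrightarrow> i \<in> S"
proof -
  have disj: "p = p'" if "p \<in> P" "p' \<in> P" "z \<in> p" "z \<in> p'" for p p' z
    using that partition_onD2[OF P] by (auto simp: disjoint_def)
  \<comment> \<open>Invariant: being due back means being the upper end of a pair of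
    \<open>P\<close>.\<close>
  have *: "matched_back S i \<longleftrightarrow> (\<exists>j. i = Suc j \<and> {j, Suc j} \<in> P)" for i
  proof (induction i)
    case (Suc i)
    have "i \<in> S \<and> \<not> matched_back S i \<longleftrightarrow> {i, Suc i} \<in> P"
    proof
      assume i: "i \<in> S \<and> \<not> matched_back S i"
      then obtain p where p: "p \<in> P" "i \<in> p" using partition_onD1[OF P] by blast
      then obtain m where m: "p = {m, Suc m}" using edges by blast
      \<comment> \<open>The alternative \<open>i = Suc m\<close> would make \<open>i\<close> an
        upper end, hence due back by the induction hypothesis.\<close>
      then have "i = m" using p i Suc by auto
      then show "{i, Suc i} \<in> P" using p m by simp
    next
      assume i: "{i, Suc i} \<in> P"
      then have "i \<in> S" using partition_onD1[OF P] by blast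
      moreover have False if mb: "matched_back S i"
      proof -
        obtain j where j: "i = Suc j" "{j, Suc j} \<in> P" using Suc mb by auto
        then have "{j, Suc j} = {i, Suc i}" using disj[OF j(2) i, of i] by simp
        then show False using j by (auto simp: doubleton_eq_iff)
      qed
      ultimately show "i \<in> S \<and> \<not> matched_back S i" by blast
    qed
    then show ?case by auto
  qed simp
  then have **: "{i, Suc i} \<in> P \<longleftrightarrow> i \<in> S \<and> \<not> matched_back S i" for i
    by (metis matched_back.simps(2) nat.inject)
  show "P = path_matching S"
    unfolding path_matching_def using edges ** by blast
  show "\<forall>i. matched_back S i \<longrightarrow> i \<in> S"
    using * partition_onD1[OF P] by blast
qed

text \<open>The greedy matching can fail only by demanding a partner outside \<open>S\<close>, which
  the hypothesis rules out.\<close>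

lemma partition_on_path_matching:
  assumes "\<forall>i. matched_back S i \<longrightarrow> i \<in> S"
  shows "partition_on S (path_matching S)"
proof (rule partition_onI)
  show "\<Union> (path_matching S) = S"
  proof (intro equalityI subsetI)
    fix i assume "i \<in> \<Union> (path_matching S)"
    then show "i \<in> S" using assms by (auto simp: path_matching_def)
  next
    fix i assume i: "i \<in> S"
    show "i \<in> \<Union> (path_matching S)"
    proof (cases "matched_back S i")
      case True
      then obtain j where "i = Suc j" "j \<in> S" "\<not> matched_back S j" by (cases i) auto
      then show ?thesis by (auto simp: path_matching_def)
    qed (use i in \<open>auto simp: path_matching_def\<close>)
  qed
  show "disjnt p p'" if "p \<in> path_matching S" "p' \<in> path_matching S" "p \<noteq> p'" for p p'
    using that by (auto simp: path_matching_def disjnt_def)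
qed (auto simp: path_matching_def)

section \<open>Interlacing sets\<close>

text \<open>With the elements in increasing order this says
  \<open>w_0 \<le> v_0 < w_1 \<le> v_1 < ... < w_n\<close>. The form with counting functions is what
  the greedy matching of a strip keeps track of.\<close>

definition interlacing :: "nat set \<Rightarrow> nat set \<Rightarrow> bool" where
  "interlacing W V \<longleftrightarrow> finite W \<and> finite V \<and> card W = Suc (card V) \<and>
     (\<forall>i. card (V \<inter> {..<i}) \<le> card (W \<inter> {..<i}) \<and>
          card (W \<inter> {..<Suc i}) \<le> Suc (card (V \<inter> {..<i})))"

text \<open>
  In the strip between the last two vertical lattice lines, position \<open>2 w\<close> is the left-pointing
  triangle at the \<open>w\<close>-th segment of its right side, position \<open>2 v + 1\<close> the right-pointing triangle at
  the \<open>v\<close>-th segment of its left side; consecutive positions are adjacent triangles.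
\<close>

definition strip_positions :: "nat \<Rightarrow> nat set \<Rightarrow> nat set \<Rightarrow> nat set" where
  "strip_positions N W V = {2..2 * N} - (\<lambda>w. 2 * w) ` W - (\<lambda>v. Suc (2 * v)) ` V"

lemma card_Int_lessThan_Suc:
  "card (W \<inter> {..<Suc i}) = card (W \<inter> {..<i}) + of_bool (i \<in> W)"
  by (simp add: lessThan_Suc Int_insert_right)

lemma strip_positions_iff:
  "2 * i \<in> strip_positions N W V \<longleftrightarrow> 1 \<le> i \<and> i \<le> N \<and> i \<notin> W"
  "Suc (2 * i) \<in> strip_positions N W V \<longleftrightarrow> 1 \<le> i \<and> i < N \<and> i \<notin> V"
  by (auto simp: strip_positions_def) presburger+

text \<open>Going up the strip, the surplus of \<open>W\<close> over \<open>V\<close> is always 0 or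
  1. It is 1 at an even position exactly when that position is due back; at odd positions the roles
  are reversed.\<close>

lemma interlacing_if_matched_back:
  assumes W: "W \<subseteq> {1..N}" and V: "V \<subseteq> {1..<N}" and N: "N \<ge> 1"
    and mb: "\<forall>i. matched_back (strip_positions N W V) i \<longrightarrow> i \<in> strip_positions N W V"
  shows "interlacing W V"
proof -
  let ?S = "strip_positions N W V"
  define w v where "w i = card (W \<inter> {..<i})" and "v i = card (V \<inter> {..<i})" for i
  have wS: "w (Suc i) = w i + of_bool (i \<in> W)" and vS: "v (Suc i) = v i + of_bool (i \<in> V)" for i
    by (simp_all add: w_def v_def card_Int_lessThan_Suc)
  \<comment> \<open>A position that is due back lies in the strip, so it is no dent; hence the two
    contributions to the surplus never add up to 2.\<close>
  have odd: "w (Suc i) = v i + of_bool (\<not> matched_back ?S (Suc (2 * i)))"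
    if "w i = v i + of_bool (matched_back ?S (2 * i))" "1 \<le> i" "i \<le> N" for i
    using that mb[rule_format, of "2 * i"] by (auto simp: wS strip_positions_iff)
  have even: "w i = v i + of_bool (matched_back ?S (2 * i))" if "i \<le> N" for i
    using that
  proof (induction i)
    case (Suc i)
    show ?case
    proof (cases "i = 0")
      case True
      \<comment> \<open>Position 1 lies below the strip, so nothing is due at position 2.\<close>
      have "W \<inter> {..<Suc 0} = {}" "V \<inter> {..<Suc 0} = {}" "Suc 0 \<notin> ?S"
        using W V by (auto simp: strip_positions_def)
      then show ?thesis using True by (simp add: w_def v_def numeral_2_eq_2)
    next
      case False
      then have "w (Suc i) = v i + of_bool (\<not> matched_back ?S (Suc (2 * i)))"
        using Suc odd by simp
      then show ?thesis
        using False Suc.prems mb[rule_format, of "Suc (2 * i)"] strip_positions_iff(2)[of i N W V]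
        by (auto simp: vS)
    qed
  qed (simp add: w_def v_def)
  have "W \<inter> {..<i} = W" "V \<inter> {..<i} = V" if "i > N" for i
    using that W V by auto
  then have wN: "w i = card W" and vN: "v i = card V" if "i > N" for i
    using that by (auto simp: w_def v_def)
  have "V \<inter> {..<N} = V" using V by auto
  then have vN': "v N = card V" by (simp add: v_def)
  \<comment> \<open>Position \<open>Suc (2 * N)\<close> lies above the strip, so nothing may be due
    there; this makes the surplus end at exactly 1.\<close>
  have "\<not> matched_back ?S (Suc (2 * N))"
    using mb[rule_format, of "Suc (2 * N)"] by (auto simp: strip_positions_iff)
  then have card: "card W = Suc (card V)"
    using odd[OF even] wN[of "Suc N"] vN' N by auto
  have "v i \<le> w i \<and> w (Suc i) \<le> Suc (v i)" for i
  proof (cases "i \<le> N")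
    case True
    moreover have "0 \<notin> W" using W by auto
    ultimately show ?thesis using even[of i] odd[of i] wS[of 0]
      by (cases "i = 0") (auto simp: w_def v_def)
  next
    case False
    then show ?thesis using wN[of i] wN[of "Suc i"] vN[of i] card by simp
  qed
  then show ?thesis
    using card W V finite_subset unfolding interlacing_def w_def v_def by blast
qed

text \<open>The same bookkeeping read backwards: a position is due where a counting inequality
  leaves no room, and that inequality then forbids removing the position.\<close>

lemma matched_back_if_interlacing:
  assumes W: "W \<subseteq> {1..N}" and V: "V \<subseteq> {1..<N}" and N: "N \<ge> 1" and int: "interlacing W V"
  shows "\<forall>i. matched_back (strip_positions N W V) i \<longrightarrow> i \<in> strip_positions N W V"
proof -
  let ?S = "strip_positions N W V"
  define w v where "w i = card (W \<inter> {..<i})" and "v i = card (V \<inter> {..<i})" for i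
  have wS: "w (Suc i) = w i + of_bool (i \<in> W)" and vS: "v (Suc i) = v i + of_bool (i \<in> V)" for i
    by (simp_all add: w_def v_def card_Int_lessThan_Suc)
  have wv: "v i \<le> w i" "w (Suc i) \<le> Suc (v i)" for i
    using int by (simp_all add: interlacing_def w_def v_def)
  have odd: "matched_back ?S (Suc (2 * i)) \<longleftrightarrow> w (Suc i) = v i"
    if "matched_back ?S (2 * i) \<longleftrightarrow> w i = Suc (v i)" "1 \<le> i" "i \<le> N" for i
    using that wv[of i] by (auto simp: wS strip_positions_iff of_bool_def split: if_splits)
  have even: "matched_back ?S (2 * i) \<longleftrightarrow> w i = Suc (v i)" if "i \<le> N" for i
    using that
  proof (induction i)
    case (Suc i)
    show ?case
    proof (cases "i = 0")
      case True
      have "W \<inter> {..<Suc 0} = {}" "V \<inter> {..<Suc 0} = {}" "Suc 0 \<notin> ?S"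
        using W V by (auto simp: strip_positions_def)
      then show ?thesis using True by (simp add: w_def v_def numeral_2_eq_2)
    next
      case False
      then have "matched_back ?S (Suc (2 * i)) \<longleftrightarrow> w (Suc i) = v i"
        using Suc odd by simp
      then show ?thesis
        using False Suc.prems wv[of i] wv[of "Suc i"] strip_positions_iff(2)[of i N W V]
        by (auto simp: vS of_bool_def split: if_splits)
    qed
  qed (simp add: w_def v_def)
  have "W \<inter> {..<Suc N} = W" "V \<inter> {..<N} = V"
    using W V by auto
  then have "w (Suc N) = Suc (v N)"
    using int by (simp add: interlacing_def w_def v_def)
  then have last: "\<not> matched_back ?S (Suc (2 * N))"
    using odd[OF even] N by simp
  show ?thesis
  proof (intro allI impI)
    fix i assume i: "matched_back ?S i"
    then obtain i' where i': "i = Suc i'" "i' \<in> ?S" by (cases i) auto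
    then have "i' \<ge> 2" "i' \<le> 2 * N" by (auto simp: strip_positions_def)
    \<comment> \<open>A due position has its predecessor in the strip, so only
      \<open>Suc (2 * N)\<close> could fall outside the range, and \<open>last\<close> excludes
      it.\<close>
    with i' i last have i2: "i \<ge> 3" "i \<le> 2 * N"
      by (auto simp: le_less)
    show "i \<in> ?S"
    proof (cases "even i")
      case True
      then obtain j where j: "i = 2 * j" by blast
      with i2 i even[of j] wv(2)[of j] show ?thesis
        by (auto simp: wS strip_positions_iff split: if_splits)
    next
      case False
      then obtain j where j: "i = Suc (2 * j)" by (metis oddE Suc_eq_plus1)
      with i2 i even[of j] odd[of j] wv(1)[of "Suc j"] show ?thesis
        by (auto simp: vS strip_positions_iff split: if_splits)
    qed
  qed
qed

section \<open>Interlacing in terms of increasing enumerations\<close>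

lemma enumerate_less_iff:
  fixes S :: "nat set"
  assumes S: "finite S" "j < card S"
  shows "enumerate S j < i \<longleftrightarrow> j < card (S \<inter> {..<i})"
proof
  assume "j < card (S \<inter> {..<i})"
  then show "enumerate S j < i"
    using finite_enumerate_in_set[of "S \<inter> {..<i}" j] finite_enumerate_initial_segment[of S j i] S
    by auto
next
  assume i: "enumerate S j < i"
  have "enumerate S ` {..j} \<subseteq> S \<inter> {..<i}"
  proof
    fix z assume "z \<in> enumerate S ` {..j}"
    then obtain m where m: "m \<le> j" "z = enumerate S m" by auto
    then have "z \<le> enumerate S j"
      using S finite_enumerate_mono[of m j S] by (auto simp: le_less)
    then show "z \<in> S \<inter> {..<i}" using m S i by (auto intro: finite_enumerate_in_set)
  qed
  then have "card (enumerate S ` {..j}) \<le> card (S \<inter> {..<i})"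
    using S by (intro card_mono) auto
  moreover have "inj_on (enumerate S) {..j}"
    by (rule inj_on_subset[OF bij_betw_imp_inj_on[OF finite_bij_enumerate[OF S(1)]]]) (use S in auto)
  ultimately show "j < card (S \<inter> {..<i})"
    by (simp add: card_image)
qed

text \<open>By \<open>enumerate_less_iff\<close>, the counting inequalities need testing only at
  \<open>i = Suc (enumerate V j)\<close> and \<open>i = enumerate W (Suc j)\<close>.\<close>

lemma interlacing_iff_enumerate:
  assumes "finite W" "finite V" "card W = Suc (card V)"
  shows "interlacing W V \<longleftrightarrow>
    (\<forall>j<card V. enumerate W j \<le> enumerate V j \<and> enumerate V j < enumerate W (Suc j))"
    (is "_ \<longleftrightarrow> ?R")
proof
  assume int: "interlacing W V"
  then have le: "card (V \<inter> {..<i}) \<le> card (W \<inter> {..<i})"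
    "card (W \<inter> {..<Suc i}) \<le> Suc (card (V \<inter> {..<i}))" for i
    by (simp_all add: interlacing_def)
  show ?R
  proof (intro allI impI conjI)
    fix j assume j: "j < card V"
    have "j < card (V \<inter> {..<Suc (enumerate V j)})"
      using j assms enumerate_less_iff[of V j "Suc (enumerate V j)"] by simp
    then have "j < card (W \<inter> {..<Suc (enumerate V j)})"
      using le(1) less_le_trans by blast
    then show "enumerate W j \<le> enumerate V j"
      using j assms enumerate_less_iff[of W j "Suc (enumerate V j)"] by simp
    have "Suc j < card (W \<inter> {..<Suc (enumerate W (Suc j))})"
      using j assms enumerate_less_iff[of W "Suc j" "Suc (enumerate W (Suc j))"] by simp
    then have "j < card (V \<inter> {..<enumerate W (Suc j)})"
      using le(2)[of "enumerate W (Suc j)"] by linarith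
    then show "enumerate V j < enumerate W (Suc j)"
      using j assms enumerate_less_iff[of V j "enumerate W (Suc j)"] by simp
  qed
next
  assume R: ?R
  have "card (V \<inter> {..<i}) \<le> card (W \<inter> {..<i})" for i
  proof (cases "card (V \<inter> {..<i})")
    case (Suc m)
    have "m < card V"
      using Suc card_mono[of V "V \<inter> {..<i}"] assms by auto
    then have "enumerate W m < i"
      using R enumerate_less_iff[of V m i] Suc assms le_less_trans by auto
    then show ?thesis
      using enumerate_less_iff[of W m i] \<open>m < card V\<close> Suc assms by auto
  qed simp
  moreover have "card (W \<inter> {..<Suc i}) \<le> Suc (card (V \<inter> {..<i}))" for i
  proof (cases "card (W \<inter> {..<Suc i}) \<le> 1")
    case False
    then obtain m where m: "card (W \<inter> {..<Suc i}) = Suc (Suc m)"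
      by (metis One_nat_def le_Suc_eq le_zero_eq not0_implies_Suc)
    have "Suc m < card W"
      using m card_mono[of W "W \<inter> {..<Suc i}"] assms by auto
    then have "enumerate V m < i"
      using R enumerate_less_iff[of W "Suc m" "Suc i"] m assms
      by (metis Suc_less_eq less_Suc_eq_le less_le_trans lessI)
    then show ?thesis
      using enumerate_less_iff[of V m i] \<open>Suc m < card W\<close> m assms by auto
  qed simp
  ultimately show "interlacing W V"
    using assms by (simp add: interlacing_def)
qed

text \<open>Exactly \<open>b 0\<close>, ..., \<open>b (j - 1)\<close> lie below \<open>b j\<close>.
  This recovers a choice function from its image in \<open>sum_interlacing\<close>.\<close>

lemma enumerate_image_strict_mono_on:
  fixes b :: "nat \<Rightarrow> nat"
  assumes b: "strict_mono_on {..<n} b" and j: "j < n"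
  shows "enumerate (b ` {..<n}) j = b j"
proof -
  let ?V = "b ` {..<n}"
  have inj: "inj_on b {..<n}" by (rule strict_mono_on_imp_inj_on[OF b])
  then have card: "card ?V = n" by (simp add: card_image)
  obtain m where m: "m < n" "enumerate ?V m = b j"
    using finite_enumerate_Ex[of ?V "b j"] j card by auto
  have "i < j \<longleftrightarrow> b i < b j" if "i < n" for i
    using strict_mono_on_less[OF b, of i j] that j by simp
  then have "?V \<inter> {..<b j} = b ` {..<j}"
    using j by (auto dest: less_trans)
  then have "card (?V \<inter> {..<b j}) = j"
    using j inj by (simp add: card_image inj_on_subset)
  then have "m = j"
    using enumerate_less_iff[of ?V m "b j"] enumerate_less_iff[of ?V m "Suc (b j)"] m card j
      card_Int_lessThan_Suc[of ?V "b j"] by simp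
  with m show ?thesis by simp
qed

text \<open>The half-open intervals lie one after another, so independent choices from them come out
  increasing.\<close>

lemma strict_mono_on_interlacing_choice:
  fixes a b :: "nat \<Rightarrow> nat"
  assumes a: "strict_mono_on {..<Suc n} a" and b: "b \<in> PiE {..<n} (\<lambda>i. {a i..<a (Suc i)})"
  shows "strict_mono_on {..<n} b"
proof (rule strict_mono_onI)
  fix r s assume rs: "r \<in> {..<n}" "s \<in> {..<n}" "r < s"
  have "b r < a (Suc r)" using PiE_mem[OF b, of r] rs by simp
  also have "\<dots> \<le> a s"
    using rs strict_mono_on_leD[OF a, of "Suc r" s] by simp
  also have "\<dots> \<le> b s" using PiE_mem[OF b, of s] rs by simp
  finally show "b r < b s" .
qed

text \<open>A set interlacing \<open>W\<close> amounts to an independent choice from each gap of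
  \<open>W\<close>. This product form lets the sum enter a determinant row by row.\<close>

lemma sum_interlacing:
  fixes W :: "nat set"
  assumes W: "finite W" "card W = Suc n"
  shows "(\<Sum>V | interlacing W V. g V) =
    (\<Sum>b\<in>PiE {..<n} (\<lambda>i. {enumerate W i..<enumerate W (Suc i)}). g (b ` {..<n}))"
proof -
  let ?B = "PiE {..<n} (\<lambda>i. {enumerate W i..<enumerate W (Suc i)})"
  have bounds: "enumerate W i \<le> b i" "b i < enumerate W (Suc i)" if "b \<in> ?B" "i < n" for b i
    using PiE_mem[OF that(1), of i] that(2) by simp_all
  have "strict_mono_on {..<Suc n} (enumerate W)"
    using W by (intro strict_mono_onI finite_enumerate_mono) auto
  note mono = strict_mono_on_interlacing_choice[OF this]
  have V: "finite V" "card V = n" if "interlacing W V" for V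
    using that W by (auto simp: interlacing_def)
  show ?thesis
  proof (rule sum.reindex_bij_witness[where j = "\<lambda>V. restrict (enumerate V) {..<n}"
        and i = "\<lambda>b. b ` {..<n}"])
    fix V assume "V \<in> {V. interlacing W V}"
    then have int: "interlacing W V" by simp
    show 1: "restrict (enumerate V) {..<n} ` {..<n} = V"
      using finite_bij_enumerate[of V] V[OF int] by (simp add: bij_betw_def)
    show "restrict (enumerate V) {..<n} \<in> ?B"
      using int interlacing_iff_enumerate[of W V] W V[OF int] by (auto simp: PiE_iff)
    show "g (restrict (enumerate V) {..<n} ` {..<n}) = g V" by (simp only: 1)
  next
    fix b assume b: "b \<in> ?B"
    have e: "enumerate (b ` {..<n}) j = b j" if "j < n" for j
      using enumerate_image_strict_mono_on[OF mono[OF b] that] .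
    then show "restrict (enumerate (b ` {..<n})) {..<n} = b"
      using b by (auto simp: PiE_iff extensional_def restrict_def)
    have "card (b ` {..<n}) = n"
      by (simp add: card_image strict_mono_on_imp_inj_on[OF mono[OF b]])
    then show "b ` {..<n} \<in> {V. interlacing W V}"
      using interlacing_iff_enumerate[of W "b ` {..<n}"] W e bounds[OF b] by simp
  qed
qed

text \<open>The extreme elements of \<open>W\<close> enclose \<open>V\<close>. So the labels
  \<open>V\<close> fit the next smaller trapezoid, whose right side has one segment fewer.\<close>

lemma interlacing_subset:
  assumes int: "interlacing W V" and W: "W \<subseteq> {1..N}"
  shows "V \<subseteq> {1..<N}"
proof
  fix v assume v: "v \<in> V"
  have fin: "finite V" and card: "card W = Suc (card V)"
    and le: "\<And>i. card (V \<inter> {..<i}) \<le> card (W \<inter> {..<i})"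
      "\<And>i. card (W \<inter> {..<Suc i}) \<le> Suc (card (V \<inter> {..<i}))"
    using int by (auto simp: interlacing_def)
  have "v \<noteq> 0"
  proof
    assume "v = 0"
    have "W \<inter> {..<Suc 0} = {}" using W by auto
    then have "card (V \<inter> {..<Suc 0}) = 0" using le(1)[of "Suc 0"] by simp
    then show False using fin v \<open>v = 0\<close> by auto
  qed
  moreover have "v < N"
  proof (rule ccontr)
    assume "\<not> v < N"
    then have "V \<inter> {..<N} \<subset> V" using v by auto
    then have "card (V \<inter> {..<N}) < card V" by (rule psubset_card_mono[OF fin])
    moreover have "W \<inter> {..<Suc N} = W" using W by auto
    ultimately show False using le(2)[of N] card by simp
  qed
  ultimately show "v \<in> {1..<N}" by simp
qed

section \<open>Lozenges\<close>

lemma card_2_common: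
  assumes "card (A \<inter> B) = 2"
  obtains p q where "p \<in> A" "p \<in> B" "q \<in> A" "q \<in> B" "p \<noteq> q"
  using assms by (fastforce simp: card_2_iff set_eq_iff)

text \<open>Distinct translates share at most one vertex. The conclusion is the equality that
  clashes with \<open>s \<noteq> t\<close> in \<open>lozenges\<close>.\<close>

lemma vertices_same_orientation:
  "card (vertices (Left_Tri c r) \<inter> vertices (Left_Tri c' r')) = 2 \<Longrightarrow> c' = c \<and> r' = r"
  "card (vertices (Right_Tri c r) \<inter> vertices (Right_Tri c' r')) = 2 \<Longrightarrow> c' = c \<and> r' = r"
  by (erule card_2_common; clarsimp; (elim disjE; clarsimp)?)+

text \<open>The three alternatives are the neighbours of the left-pointing triangle across its
  vertical, upper and lower side.\<close>

lemma vertices_opposite_orientation: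
  "card (vertices (Left_Tri c r) \<inter> vertices (Right_Tri c' r')) = 2 \<longleftrightarrow>
     c' = c \<and> r' = r \<or> c' = c - 1 \<and> (r' = r \<or> r' = r - 1)"
proof
  assume "card (vertices (Left_Tri c r) \<inter> vertices (Right_Tri c' r')) = 2"
  then show "c' = c \<and> r' = r \<or> c' = c - 1 \<and> (r' = r \<or> r' = r - 1)"
    by (rule card_2_common) force
next
  assume "c' = c \<and> r' = r \<or> c' = c - 1 \<and> (r' = r \<or> r' = r - 1)"
  then have "vertices (Left_Tri c r) \<inter> vertices (Right_Tri c' r') \<in>
      {{(c, r), (c, r + 1)}, {(c - 1, r), (c, r + 1)}, {(c - 1, r), (c, r)}}"
    by (elim disjE conjE) auto
  then show "card (vertices (Left_Tri c r) \<inter> vertices (Right_Tri c' r')) = 2"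
    by auto
qed

lemma lozenges_iff:
  "l \<in> lozenges \<longleftrightarrow> (\<exists>c r. l = {Left_Tri c r, Right_Tri c r} \<or>
     l = {Left_Tri c r, Right_Tri (c - 1) r} \<or> l = {Left_Tri c r, Right_Tri (c - 1) (r - 1)})"
  (is "_ \<longleftrightarrow> ?R")
proof
  assume "l \<in> lozenges"
  then obtain s t where l: "l = {s, t}" "s \<noteq> t" "card (vertices s \<inter> vertices t) = 2"
    unfolding lozenges_def by auto
  show ?R
  proof (cases s; cases t)
    fix c r c' r' assume "s = Left_Tri c r" "t = Left_Tri c' r'"
    with l vertices_same_orientation(1)[of c r c' r'] show ?R by metis
  next
    fix c r c' r' assume "s = Right_Tri c r" "t = Right_Tri c' r'"
    with l vertices_same_orientation(2)[of c r c' r'] show ?R by metis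
  next
    fix c r c' r' assume "s = Left_Tri c r" "t = Right_Tri c' r'"
    with l vertices_opposite_orientation[of c r c' r'] show ?R by blast
  next
    fix c r c' r' assume "s = Right_Tri c' r'" "t = Left_Tri c r"
    with l vertices_opposite_orientation[of c r c' r'] show ?R
      by (metis Int_commute insert_commute)
  qed
next
  have *: "{Left_Tri c r, Right_Tri c' r'} \<in> lozenges"
    if "c' = c \<and> r' = r \<or> c' = c - 1 \<and> (r' = r \<or> r' = r - 1)" for c r c' r'
    unfolding lozenges_def
    using triangle.distinct(1) vertices_opposite_orientation[THEN iffD2, OF that] by blast
  assume ?R
  then show "l \<in> lozenges" using * by blast
qed

lemma shared_edge_pair: "shared_edge {s, t} = vertices s \<inter> vertices t"
  by (simp add: shared_edge_def)

lemma lozenge_weight_horizontal: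
  "lozenge_weight x q X Y k {Left_Tri c r, Right_Tri c r} =
     wt q X Y (k + 2 * r + 1 - c - int x)"
proof -
  have e: "shared_edge {Left_Tri c r, Right_Tri c r} = {(c, r), (c, r + 1)}"
    by (auto simp: shared_edge_pair)
  then have "horizontal {Left_Tri c r, Right_Tri c r}"
    by (auto simp: horizontal_def)
  moreover have "center_i_coord x k {Left_Tri c r, Right_Tri c r} = k + 2 * r + 1 - c - int x"
    by (simp add: center_i_coord_def e i_coord_def)
  ultimately show ?thesis by (simp add: lozenge_weight_def)
qed

lemma lozenge_weight_slanted:
  assumes "r' = r \<or> r' = r - 1"
  shows "lozenge_weight x q X Y k {Left_Tri c r, Right_Tri (c - 1) r'} = 1"
proof -
  \<comment> \<open>The two ends of the shared edge, which lie on different vertical lines.\<close>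
  have "(c - 1, r) \<in> shared_edge {Left_Tri c r, Right_Tri (c - 1) r'}"
    "(c, r' + 1) \<in> shared_edge {Left_Tri c r, Right_Tri (c - 1) r'}"
    using assms by (auto simp: shared_edge_pair)
  then have "\<not> horizontal {Left_Tri c r, Right_Tri (c - 1) r'}"
    unfolding horizontal_def by (metis fst_conv diff_add_cancel less_irrefl zless_add1_eq)
  then show ?thesis by (simp add: lozenge_weight_def)
qed

section \<open>Cutting off the last strip\<close>

lemma partition_on_Un:
  assumes "partition_on A P" "partition_on B Q" "A \<inter> B = {}"
  shows "partition_on (A \<union> B) (P \<union> Q)"
  unfolding partition_on_def
proof (intro conjI)
  show "disjoint (P \<union> Q)"
    using assms by (intro disjoint_union) (auto simp: partition_on_def)
  show "\<Union> (P \<union> Q) = A \<union> B" "{} \<notin> P \<union> Q"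
    using assms(1,2)[THEN partition_onD1] assms(1,2)[THEN partition_onD3] by simp_all
qed

text \<open>The path of triangles behind \<open>strip_positions\<close>, for the strip that
  separates width \<open>y\<close> from width \<open>Suc y\<close>. The \<open>- 1\<close> is there
  because labels count from 1 and rows from 0.\<close>

definition strip_triangle :: "nat \<Rightarrow> nat \<Rightarrow> triangle" where
  "strip_triangle y i =
     (if even i then Left_Tri (int y + 1) (int (i div 2) - 1)
      else Right_Tri (int y) (int (i div 2) - 1))"

lemma strip_triangle_simps:
  "strip_triangle y (2 * w) = Left_Tri (int y + 1) (int w - 1)"
  "strip_triangle y (Suc (2 * w)) = Right_Tri (int y) (int w - 1)"
  by (simp_all add: strip_triangle_def)

lemma inj_strip_triangle: "inj (strip_triangle y)"
proof (rule injI)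
  fix i j assume eq: "strip_triangle y i = strip_triangle y j"
  then have "even i \<longleftrightarrow> even j" "i div 2 = j div 2"
    by (auto simp: strip_triangle_def split: if_splits)
  then show "i = j" by (metis dvd_mult_div_cancel odd_two_times_div_two_succ)
qed

lemma Left_Tri_in_strip: "Left_Tri c r \<in> range (strip_triangle y) \<longleftrightarrow> c = int y + 1 \<and> r \<ge> - 1"
proof
  assume "c = int y + 1 \<and> r \<ge> - 1"
  then have "Left_Tri c r = strip_triangle y (2 * nat (r + 1))"
    by (simp add: strip_triangle_simps)
  then show "Left_Tri c r \<in> range (strip_triangle y)" by simp
qed (auto simp: strip_triangle_def split: if_splits)

section \<open>Trapezoids of consecutive widths\<close>

lemma Left_Tri_in_trapezoid:
  "Left_Tri c r \<in> trapezoid x y \<longleftrightarrow> 1 \<le> c \<and> c \<le> int y \<and> 0 \<le> r \<and> r < int x + c"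
  by (auto simp: trapezoid_def)

lemma Right_Tri_in_trapezoid:
  "Right_Tri c r \<in> trapezoid x y \<longleftrightarrow> 0 \<le> c \<and> c < int y \<and> 0 \<le> r \<and> r < int x + c"
  by (auto simp: trapezoid_def)

lemmas in_trapezoid = Left_Tri_in_trapezoid Right_Tri_in_trapezoid

lemma strip_triangle_in_trapezoid:
  "strip_triangle y i \<notin> trapezoid x y"
  "strip_triangle y i \<in> trapezoid x (Suc y) \<longleftrightarrow> i \<in> {2..2 * (x + y + 1)}"
  by (auto simp: strip_triangle_def in_trapezoid) presburger+

lemma trapezoid_0: "trapezoid x 0 = {}"
proof -
  have "t \<notin> trapezoid x 0" for t by (cases t) (auto simp: in_trapezoid)
  then show ?thesis by blast
qed

lemma trapezoid_Suc:
  "trapezoid x (Suc y) = trapezoid x y \<union> strip_triangle y ` {2..2 * (x + y + 1)}"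
proof (intro equalityI subsetI)
  fix t assume t: "t \<in> trapezoid x (Suc y)"
  show "t \<in> trapezoid x y \<union> strip_triangle y ` {2..2 * (x + y + 1)}"
  proof (cases "t \<in> trapezoid x y")
    case False
    have "t \<in> range (strip_triangle y)"
    proof (cases t)
      case (Left_Tri c r)
      then show ?thesis using t False by (auto simp: Left_Tri_in_strip in_trapezoid)
    next
      case (Right_Tri c r)
      then have "t = strip_triangle y (Suc (2 * nat (r + 1)))"
        using t False by (auto simp: strip_triangle_simps in_trapezoid)
      then show ?thesis by simp
    qed
    then show ?thesis using t strip_triangle_in_trapezoid(2)[of y _ x] by auto
  qed simp
next
  fix t assume "t \<in> trapezoid x y \<union> strip_triangle y ` {2..2 * (x + y + 1)}"
  then consider "t \<in> trapezoid x y" | i where "i \<in> {2..2 * (x + y + 1)}" "t = strip_triangle y i"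
    by blast
  then show "t \<in> trapezoid x (Suc y)"
  proof cases
    case 1
    then show ?thesis by (cases t) (auto simp: in_trapezoid)
  next
    case 2
    then show ?thesis by (simp only: strip_triangle_in_trapezoid(2))
  qed
qed

lemma finite_trapezoid: "finite (trapezoid x y)"
  by (induction y) (simp_all add: trapezoid_0 trapezoid_Suc)

lemma finite_tilings: "finite (tilings x y W)"
proof (rule finite_subset)
  show "tilings x y W \<subseteq> Pow (Pow (trapezoid x y))"
    by (auto simp: tilings_def partition_on_def)
qed (simp add: finite_trapezoid)

lemma finite_tiling:
  assumes "T \<in> tilings x y W"
  shows "finite T"
proof (rule finite_subset)
  show "T \<subseteq> Pow (trapezoid x y)"
    using assms by (auto simp: tilings_def partition_on_def)
qed (simp add: finite_trapezoid)

lemma dents_Suc: "dents (Suc y) W = strip_triangle y ` (\<lambda>w. 2 * w) ` W"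
  by (auto simp: dents_def strip_triangle_simps image_image)

text \<open>The horizontal lozenge across the cut: its left half serves as a dent of the smaller
  trapezoid, its right half is an odd position of the strip.\<close>

definition cross_lozenge :: "nat \<Rightarrow> nat \<Rightarrow> triangle set" where
  "cross_lozenge y v = {Left_Tri (int y) (int v - 1), Right_Tri (int y) (int v - 1)}"

lemma cross_lozenge_altdef:
  "cross_lozenge y v = {Left_Tri (int y) (int v - 1), strip_triangle y (Suc (2 * v))}"
  by (simp add: cross_lozenge_def strip_triangle_simps)

lemma Left_Tri_notin_strip: "Left_Tri (int y) r \<noteq> strip_triangle y i"
  by (simp add: strip_triangle_def)

lemma cross_lozenge_not_subset:
  "\<not> cross_lozenge y v \<subseteq> trapezoid x y" "\<not> cross_lozenge y v \<subseteq> range (strip_triangle y)"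
  using strip_triangle_in_trapezoid(1) Left_Tri_notin_strip
  by (auto simp: cross_lozenge_altdef)

lemma inj_cross_lozenge: "inj (cross_lozenge y)"
  by (auto simp: inj_def cross_lozenge_def doubleton_eq_iff)

lemma strip_lozenge: "strip_triangle y ` {i, Suc i} \<in> lozenges"
proof (cases "even i")
  case True
  then obtain w where "i = 2 * w" by blast
  then have "strip_triangle y ` {i, Suc i} =
      {Left_Tri (int y + 1) (int w - 1), Right_Tri (int y + 1 - 1) (int w - 1)}"
    by (simp add: strip_triangle_simps)
  then show ?thesis unfolding lozenges_iff by blast
next
  case False
  then obtain w where i: "i = Suc (2 * w)" by (metis oddE Suc_eq_plus1)
  \<comment> \<open>\<open>Suc i\<close> is the left-pointing triangle of the next label, and
    position \<open>i\<close> is its neighbour across the lower side.\<close>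
  then have "strip_triangle y ` {i, Suc i} =
      {Left_Tri (int y + 1) (int (Suc w) - 1), Right_Tri (int y + 1 - 1) (int (Suc w) - 1 - 1)}"
    using strip_triangle_simps(1)[of y "Suc w"] by (simp add: strip_triangle_simps insert_commute)
  then show ?thesis unfolding lozenges_iff by blast
qed

lemma lozenge_weight_strip: "lozenge_weight x q X Y k (strip_triangle y ` {i, Suc i}) = 1"
proof (cases "even i")
  case True
  then obtain w where "i = 2 * w" by blast
  then show ?thesis
    using lozenge_weight_slanted[of "int w - 1" "int w - 1" x q X Y k "int y + 1"]
    by (simp add: strip_triangle_simps)
next
  case False
  then obtain w where i: "i = Suc (2 * w)" by (metis oddE Suc_eq_plus1)
  then show ?thesis
    using lozenge_weight_slanted[of "int w - 1" "int w" x q X Y k "int y + 1"]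
      strip_triangle_simps(1)[of y "Suc w"]
    by (simp add: strip_triangle_simps insert_commute)
qed

text \<open>The column \<open>c\<close> of the left-pointing triangle decides. A horizontal lozenge
  with \<open>c = y\<close> straddles the cut, a slanted one with \<open>c = y + 1\<close> lies in
  the strip, and all others lie left of the cut; a horizontal one with \<open>c = y + 1\<close>
  would leave the trapezoid.\<close>

lemma lozenge_cases:
  assumes "l \<in> lozenges" "l \<subseteq> trapezoid x (Suc y)"
  obtains "l \<subseteq> trapezoid x y" | v where "l = cross_lozenge y v"
    | i where "l = strip_triangle y ` {i, Suc i}"
proof -
  obtain c r where "l = {Left_Tri c r, Right_Tri c r} \<or> l = {Left_Tri c r, Right_Tri (c - 1) r} \<or>
      l = {Left_Tri c r, Right_Tri (c - 1) (r - 1)}"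
    using assms(1) unfolding lozenges_iff by blast
  then consider (h) "l = {Left_Tri c r, Right_Tri c r}" | (s) "l = {Left_Tri c r, Right_Tri (c - 1) r}"
    | (t) "l = {Left_Tri c r, Right_Tri (c - 1) (r - 1)}" by blast
  then show thesis
  proof cases
    case h
    show thesis
    proof (cases "c = int y")
      case True
      then have "l = cross_lozenge y (nat (r + 1))"
        using h assms(2) by (simp add: cross_lozenge_def in_trapezoid)
      then show thesis by (rule that(2))
    next
      case False
      then show thesis using h assms(2) by (intro that(1)) (auto simp: in_trapezoid)
    qed
  next
    case s
    show thesis
    proof (cases "c = int y + 1")
      case True
      then have "l = strip_triangle y ` {2 * nat (r + 1), Suc (2 * nat (r + 1))}"
        using s assms(2) by (simp add: strip_triangle_simps in_trapezoid)
      then show thesis by (rule that(3))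
    next
      case False
      then show thesis using s assms(2) by (intro that(1)) (auto simp: in_trapezoid)
    qed
  next
    case t
    show thesis
    proof (cases "c = int y + 1")
      case True
      then have "l = strip_triangle y ` {Suc (2 * nat r), 2 * nat (r + 1)}"
        using t assms(2) by (auto simp: strip_triangle_simps in_trapezoid)
      moreover have "2 * nat (r + 1) = Suc (Suc (2 * nat r))"
        using t assms(2) by (simp add: in_trapezoid nat_add_distrib)
      ultimately show thesis by (intro that(3)) simp
    next
      case False
      then show thesis using t assms(2) by (intro that(1)) (auto simp: in_trapezoid)
    qed
  qed
qed

section \<open>Gluing and cutting tilings\<close>

definition strip_tiling :: "nat \<Rightarrow> nat \<Rightarrow> nat set \<Rightarrow> nat set \<Rightarrow> triangle set set" where
  "strip_tiling x y W V =
     (`) (strip_triangle y) ` path_matching (strip_positions (x + y + 1) W V)"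

definition extend_tiling ::
    "nat \<Rightarrow> nat \<Rightarrow> nat set \<Rightarrow> nat set \<Rightarrow> triangle set set \<Rightarrow> triangle set set" where
  "extend_tiling x y W V T = T \<union> cross_lozenge y ` V \<union> strip_tiling x y W V"

lemma strip_tiling_cases:
  assumes "l \<in> strip_tiling x y W V"
  obtains i where "l = strip_triangle y ` {i, Suc i}"
  using assms by (auto simp: strip_tiling_def path_matching_def)

text \<open>The three families tile disjoint regions: the dented smaller trapezoid; its dents
  together with the odd positions of \<open>V\<close>; and the rest of the strip, where interlacing
  makes the greedy matching succeed.\<close>

lemma extend_tiling_in_tilings:
  assumes W: "W \<subseteq> {1..x + y + 1}" and int: "interlacing W V" and T: "T \<in> tilings x y V"
  shows "extend_tiling x y W V T \<in> tilings x (Suc y) W"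
proof -
  let ?N = "x + y + 1" and ?K = "trapezoid x y" and ?t = "strip_triangle y"
  let ?S = "strip_positions ?N W V"
  have V: "V \<subseteq> {1..<?N}" by (rule interlacing_subset[OF int W])
  have TD: "T \<subseteq> lozenges" "dents y V \<subseteq> ?K" "partition_on (?K - dents y V) T"
    using T by (auto simp: tilings_def)
  have cross: "cross_lozenge y v \<in> lozenges" for v
    unfolding lozenges_iff cross_lozenge_def by blast
  have "partition_on ?S (path_matching ?S)"
    using matched_back_if_interlacing[OF W V _ int] by (intro partition_on_path_matching) simp
  \<comment> \<open>\<open>partition_on_inj_image\<close> discards an empty block; none occurs, as
    shown next.\<close>
  then have "partition_on (?t ` ?S) (strip_tiling x y W V - {{}})"
    unfolding strip_tiling_def using inj_on_subset[OF inj_strip_triangle]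
    by (intro partition_on_inj_image) auto
  moreover have "{} \<notin> strip_tiling x y W V"
    by (auto elim: strip_tiling_cases)
  ultimately have strip: "partition_on (?t ` ?S) (strip_tiling x y W V)" by simp
  have "partition_on (\<Union> (cross_lozenge y ` V)) (cross_lozenge y ` V)"
    by (rule partition_onI) (auto simp: cross_lozenge_def disjnt_def)
  moreover have "\<Union> (cross_lozenge y ` V) = dents y V \<union> ?t ` (\<lambda>v. Suc (2 * v)) ` V"
    by (auto simp: cross_lozenge_altdef dents_def)
  ultimately have "partition_on (dents y V \<union> ?t ` (\<lambda>v. Suc (2 * v)) ` V) (cross_lozenge y ` V)"
    by simp
  then have "partition_on ((?K - dents y V) \<union> (dents y V \<union> ?t ` (\<lambda>v. Suc (2 * v)) ` V))
      (T \<union> cross_lozenge y ` V)"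
    using TD(3) strip_triangle_in_trapezoid(1)[of y _ x]
    by (intro partition_on_Un) auto
  then have "partition_on ((?K - dents y V) \<union> (dents y V \<union> ?t ` (\<lambda>v. Suc (2 * v)) ` V) \<union> ?t ` ?S)
      (extend_tiling x y W V T)"
    unfolding extend_tiling_def
  proof (rule partition_on_Un[OF _ strip])
    have "?t ` (\<lambda>v. Suc (2 * v)) ` V \<inter> ?t ` ?S = ?t ` ((\<lambda>v. Suc (2 * v)) ` V \<inter> ?S)"
      by (rule image_Int[OF inj_strip_triangle, symmetric])
    also have "(\<lambda>v. Suc (2 * v)) ` V \<inter> ?S = {}"
      by (auto simp: strip_positions_def)
    finally show "((?K - dents y V) \<union> (dents y V \<union> ?t ` (\<lambda>v. Suc (2 * v)) ` V)) \<inter> ?t ` ?S = {}"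
      using strip_triangle_in_trapezoid(1)[of y _ x] TD(2) by auto
  qed
  moreover have "(?K - dents y V) \<union> (dents y V \<union> ?t ` (\<lambda>v. Suc (2 * v)) ` V) \<union> ?t ` ?S =
      trapezoid x (Suc y) - dents (Suc y) W"
  proof -
    have "(\<lambda>v. Suc (2 * v)) ` V \<union> ?S = {2..2 * ?N} - (\<lambda>w. 2 * w) ` W"
      using V by (auto simp: strip_positions_def) presburger+
    then have "?t ` (\<lambda>v. Suc (2 * v)) ` V \<union> ?t ` ?S = ?t ` {2..2 * ?N} - dents (Suc y) W"
      unfolding dents_Suc image_set_diff[OF inj_strip_triangle, symmetric]
      by (simp only: image_Un[symmetric])
    moreover have "?K \<inter> dents (Suc y) W = {}"
      using strip_triangle_in_trapezoid(1)[of y _ x] by (auto simp: dents_Suc)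
    ultimately show ?thesis
      unfolding trapezoid_Suc using TD(2) by blast
  qed
  moreover have "dents (Suc y) W \<subseteq> trapezoid x (Suc y)"
    using W by (auto simp: dents_def in_trapezoid)
  moreover have "extend_tiling x y W V T \<subseteq> lozenges"
    using TD(1) cross strip_lozenge by (auto simp: extend_tiling_def elim!: strip_tiling_cases)
  ultimately show ?thesis by (simp add: tilings_def)
qed

lemma tiling_lozenge_disjoint:
  assumes "T \<in> tilings x y W" "l \<in> T" "l' \<in> T" "t \<in> l" "t \<in> l'"
  shows "l = l'"
  using assms partition_onD2 by (fastforce simp: tilings_def disjoint_def)

text \<open>Sorting the lozenges of \<open>T\<close> by \<open>lozenge_cases\<close> gives
  \<open>T'\<close>, \<open>V\<close> and a matching \<open>P\<close> of the remaining strip.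
  Uniqueness of matchings identifies \<open>P\<close>, and its existence forces interlacing.\<close>

lemma tilings_Suc_decompose:
  assumes W: "W \<subseteq> {1..x + y + 1}" and T: "T \<in> tilings x (Suc y) W"
  obtains V T' where "interlacing W V" "T' \<in> tilings x y V" "T = extend_tiling x y W V T'"
proof -
  let ?N = "x + y + 1" and ?K = "trapezoid x y" and ?t = "strip_triangle y"
  define V where "V = {v. cross_lozenge y v \<in> T}"
  define T' where "T' = {l \<in> T. l \<subseteq> ?K}"
  define P where "P = {p \<in> range (\<lambda>i. {i, Suc i}). ?t ` p \<in> T}"
  let ?S = "strip_positions ?N W V"
  have loz: "T \<subseteq> lozenges"
    and part: "partition_on (trapezoid x (Suc y) - dents (Suc y) W) T"
    using T by (auto simp: tilings_def)
  have Union: "\<Union> T = trapezoid x (Suc y) - dents (Suc y) W"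
    using partition_onD1[OF part] by simp
  have t_notin: "?t i \<notin> ?K" for i by (rule strip_triangle_in_trapezoid(1))
  have cases: thesis
    if "l \<in> T" "l \<in> T' \<Longrightarrow> thesis" "\<And>v. v \<in> V \<Longrightarrow> l = cross_lozenge y v \<Longrightarrow> thesis"
      "\<And>i. {i, Suc i} \<in> P \<Longrightarrow> l = ?t ` {i, Suc i} \<Longrightarrow> thesis" for l thesis
  proof -
    have "l \<in> lozenges" "l \<subseteq> trapezoid x (Suc y)" using that(1) loz Union by blast+
    then show thesis
    proof (cases rule: lozenge_cases)
      case 1
      then show thesis using that(1,2) by (simp add: T'_def)
    next
      case (2 v)
      then show thesis using that(1,3) by (simp add: V_def)
    next
      case (3 i)
      then show thesis using that(1,4) by (simp add: P_def)
    qed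
  qed
  have V: "V \<subseteq> {1..<?N}"
  proof
    fix v assume "v \<in> V"
    then have "Right_Tri (int y) (int v - 1) \<in> \<Union> T"
      by (auto simp: V_def cross_lozenge_def)
    then show "v \<in> {1..<?N}" by (auto simp: Union in_trapezoid)
  qed
  \<comment> \<open>Only the left half of a cross lozenge lies left of the cut, so the dents are
    what these lozenges take from the smaller trapezoid.\<close>
  have dents: "t \<in> dents y V \<longleftrightarrow> t \<in> ?K \<and> (\<exists>v\<in>V. t \<in> cross_lozenge y v)" for t
  proof
    assume "t \<in> dents y V"
    then obtain v where v: "v \<in> V" "t = Left_Tri (int y) (int v - 1)" by (auto simp: dents_def)
    then have t: "t \<in> cross_lozenge y v" by (simp add: cross_lozenge_def)
    then have "t \<in> trapezoid x (Suc y)" using v Union by (auto simp: V_def)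
    then have "t \<in> ?K" using v(2) by (auto simp: trapezoid_Suc Left_Tri_notin_strip)
    with v t show "t \<in> ?K \<and> (\<exists>v\<in>V. t \<in> cross_lozenge y v)" by blast
  qed (auto simp: dents_def cross_lozenge_altdef t_notin)
  have "\<Union> T' = ?K - dents y V"
  proof (intro equalityI subsetI)
    fix t assume "t \<in> \<Union> T'"
    then obtain l where l: "l \<in> T" "l \<subseteq> ?K" "t \<in> l" by (auto simp: T'_def)
    have "t \<notin> dents y V"
    proof
      assume "t \<in> dents y V"
      then obtain v where "v \<in> V" "t \<in> cross_lozenge y v" using dents by blast
      then have "l = cross_lozenge y v"
        using tiling_lozenge_disjoint[OF T l(1) _ l(3)] by (simp add: V_def)
      then show False using l(2) cross_lozenge_not_subset(1) by blast
    qed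
    then show "t \<in> ?K - dents y V" using l by blast
  next
    fix t assume t: "t \<in> ?K - dents y V"
    then have "t \<in> \<Union> T" unfolding Union trapezoid_Suc dents_Suc using t_notin by auto
    then obtain l where l: "l \<in> T" "t \<in> l" by blast
    from l(1) show "t \<in> \<Union> T'"
      by (rule cases) (use t l(2) dents t_notin in auto)
  qed
  moreover have "disjoint T'" "{} \<notin> T'" "T' \<subseteq> lozenges"
    using partition_onD2[OF part] partition_onD3[OF part] loz
    by (auto simp: T'_def disjoint_def)
  ultimately have T': "T' \<in> tilings x y V"
    using dents by (auto simp: tilings_def partition_on_def)
  have i_iff: "i \<in> {2..2 * ?N} - (\<lambda>w. 2 * w) ` W \<longleftrightarrow> ?t i \<in> \<Union> T" for i
    unfolding Union dents_Suc using strip_triangle_in_trapezoid(2)[of y i x] inj_strip_triangle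
    by (simp add: inj_image_mem_iff)
  have cross_iff: "?t i \<in> cross_lozenge y v \<longleftrightarrow> i = Suc (2 * v)" for i v
    using inj_strip_triangle Left_Tri_notin_strip[of y _ i]
    by (auto simp: cross_lozenge_altdef inj_eq eq_commute)
  have "\<Union> P = ?S"
  proof (intro equalityI subsetI)
    fix i assume "i \<in> \<Union> P"
    then obtain p where p: "?t ` p \<in> T" "i \<in> p" unfolding P_def by blast
    then have "i \<in> {2..2 * ?N} - (\<lambda>w. 2 * w) ` W" unfolding i_iff by blast
    moreover have "i \<noteq> Suc (2 * v)" if "v \<in> V" for v
    proof
      assume "i = Suc (2 * v)"
      then have "cross_lozenge y v = ?t ` p"
        using tiling_lozenge_disjoint[OF T _ p(1), of "cross_lozenge y v" "?t i"] that p(2) cross_iff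
        by (auto simp: V_def)
      then show False using cross_lozenge_not_subset(2)[of y v] by auto
    qed
    ultimately show "i \<in> ?S" by (auto simp: strip_positions_def)
  next
    fix i assume i: "i \<in> ?S"
    then have "?t i \<in> \<Union> T" unfolding i_iff[symmetric] by (simp add: strip_positions_def)
    then obtain l where l: "l \<in> T" "?t i \<in> l" by blast
    from l(1) show "i \<in> \<Union> P"
    proof (rule cases)
      assume "l \<in> T'"
      then show ?thesis using l(2) t_notin by (auto simp: T'_def)
    next
      fix v assume "v \<in> V" "l = cross_lozenge y v"
      then show ?thesis using i l(2) cross_iff by (auto simp: strip_positions_def)
    next
      fix j assume "{j, Suc j} \<in> P" "l = ?t ` {j, Suc j}"
      then show ?thesis
        using l(2) inj_image_mem_iff[OF inj_strip_triangle, of y i "{j, Suc j}"] by blast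
    qed
  qed
  moreover have "disjnt p p'" if "p \<in> P" "p' \<in> P" "p \<noteq> p'" for p p'
  proof -
    have "?t ` p \<noteq> ?t ` p'" using that(3) inj_image_eq_iff[OF inj_strip_triangle] by blast
    then show ?thesis
      using that tiling_lozenge_disjoint[OF T] unfolding P_def disjnt_def by blast
  qed
  moreover have "{} \<notin> P" by (auto simp: P_def)
  ultimately have part_P: "partition_on ?S P" by (intro partition_onI)
  have P: "P = path_matching ?S" "interlacing W V"
    using path_matching_unique[OF part_P] interlacing_if_matched_back[OF W V]
    by (auto simp: P_def)
  have "T = T' \<union> cross_lozenge y ` V \<union> (`) ?t ` P"
  proof (intro equalityI subsetI)
    fix l assume "l \<in> T"
    then show "l \<in> T' \<union> cross_lozenge y ` V \<union> (`) ?t ` P" by (rule cases) blast+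
  qed (auto simp: T'_def V_def P_def)
  then have "T = extend_tiling x y W V T'"
    by (simp add: extend_tiling_def strip_tiling_def P(1))
  with P(2) T' show thesis by (rule that)
qed

lemma tiling_lozenge_subset: "T \<in> tilings x y W \<Longrightarrow> l \<in> T \<Longrightarrow> l \<subseteq> trapezoid x y"
  by (auto simp: tilings_def partition_on_def)

lemma strip_tiling_subset:
  assumes "l \<in> strip_tiling x y W V"
  shows "l \<subseteq> range (strip_triangle y)" "\<not> l \<subseteq> trapezoid x y"
  using assms by (auto elim!: strip_tiling_cases simp: strip_triangle_in_trapezoid(1))

text \<open>The three kinds of lozenges differ in their position relative to the cut, so gluing
  loses no information.\<close>

lemma extend_tiling_recover:
  assumes T: "T \<in> tilings x y V"
  shows "cross_lozenge y v \<in> extend_tiling x y W V T \<longleftrightarrow> v \<in> V"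
    and "l \<in> T \<longleftrightarrow> l \<in> extend_tiling x y W V T \<and> l \<subseteq> trapezoid x y"
proof -
  note sub = tiling_lozenge_subset[OF T]
  show "cross_lozenge y v \<in> extend_tiling x y W V T \<longleftrightarrow> v \<in> V"
  proof -
    have "cross_lozenge y v \<notin> T" "cross_lozenge y v \<notin> strip_tiling x y W V"
      using sub[of "cross_lozenge y v"] strip_tiling_subset(1)[of "cross_lozenge y v" x y W V]
        cross_lozenge_not_subset[of y v] by blast+
    then show ?thesis
      by (simp add: extend_tiling_def inj_image_mem_iff[OF inj_cross_lozenge])
  qed
  show "l \<in> T \<longleftrightarrow> l \<in> extend_tiling x y W V T \<and> l \<subseteq> trapezoid x y"
    using sub strip_tiling_subset(2) cross_lozenge_not_subset(1)
    by (auto simp: extend_tiling_def)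
qed

lemma bij_betw_extend_tiling:
  assumes W: "W \<subseteq> {1..x + y + 1}"
  shows "bij_betw (\<lambda>(V, T). extend_tiling x y W V T)
    (SIGMA V:{V. interlacing W V}. tilings x y V) (tilings x (Suc y) W)"
  unfolding bij_betw_def
proof
  show "inj_on (\<lambda>(V, T). extend_tiling x y W V T) (SIGMA V:{V. interlacing W V}. tilings x y V)"
  proof (rule inj_onI, clarify)
    fix V T V' T'
    assume T: "T \<in> tilings x y V" "T' \<in> tilings x y V'"
      and eq: "extend_tiling x y W V T = extend_tiling x y W V' T'"
    show "V = V' \<and> T = T'"
      using extend_tiling_recover[OF T(1), where W = W] extend_tiling_recover[OF T(2), where W = W] eq
      by blast
  qed
  show "(\<lambda>(V, T). extend_tiling x y W V T) ` (SIGMA V:{V. interlacing W V}. tilings x y V) =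
      tilings x (Suc y) W"
  proof (intro equalityI subsetI)
    fix T assume "T \<in> tilings x (Suc y) W"
    then obtain V T' where "interlacing W V" "T' \<in> tilings x y V" "T = extend_tiling x y W V T'"
      using tilings_Suc_decompose[OF W] by blast
    then show "T \<in> (\<lambda>(V, T). extend_tiling x y W V T) ` (SIGMA V:{V. interlacing W V}. tilings x y V)"
      by force
  qed (auto intro: extend_tiling_in_tilings[OF W])
qed

section \<open>Recursion for the tiling sum\<close>

lemma prod_lozenge_weight_extend_tiling:
  assumes W: "W \<subseteq> {1..x + y + 1}" and int: "interlacing W V" and T: "T \<in> tilings x y V"
  shows "(\<Prod>l\<in>extend_tiling x y W V T. lozenge_weight x q X Y k l) =
    (\<Prod>v\<in>V. wt q X Y (2 * int v + k - (int x + int y + 1))) * (\<Prod>l\<in>T. lozenge_weight x q X Y k l)"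
proof -
  let ?w = "lozenge_weight x q X Y k"
  have fin: "finite (extend_tiling x y W V T)"
    using extend_tiling_in_tilings[OF W int T] by (rule finite_tiling)
  have "l \<notin> T" if "l \<in> cross_lozenge y ` V" for l
    using that tiling_lozenge_subset[OF T] cross_lozenge_not_subset(1) by blast
  moreover have "l \<notin> T" if "l \<in> strip_tiling x y W V" for l
    using tiling_lozenge_subset[OF T] strip_tiling_subset(2)[OF that] by blast
  moreover have "l \<notin> cross_lozenge y ` V" if "l \<in> strip_tiling x y W V" for l
    using strip_tiling_subset(1)[OF that] cross_lozenge_not_subset(2) by blast
  ultimately have disj: "T \<inter> cross_lozenge y ` V = {}"
    "(T \<union> cross_lozenge y ` V) \<inter> strip_tiling x y W V = {}"
    by blast+
  \<comment> \<open>The factor of \<open>T\<close> is the same in both trapezoids, since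
    \<open>lozenge_weight\<close> refers to the left side only, through \<open>x\<close>.\<close>
  have "prod ?w (extend_tiling x y W V T) =
      prod ?w T * prod ?w (cross_lozenge y ` V) * prod ?w (strip_tiling x y W V)"
    using fin disj unfolding extend_tiling_def by (simp add: prod.union_disjoint)
  also have "prod ?w (strip_tiling x y W V) = 1"
    by (rule prod.neutral) (auto elim!: strip_tiling_cases simp only: lozenge_weight_strip)
  \<comment> \<open>\<open>lozenge_weight_horizontal\<close> at column \<open>y\<close> and row
    \<open>v - 1\<close> gives the exponent \<open>k + 2 * (v - 1) + 1 - y - x\<close>.\<close>
  also have "prod ?w (cross_lozenge y ` V) =
      (\<Prod>v\<in>V. wt q X Y (2 * int v + k - (int x + int y + 1)))"
    by (subst prod.reindex[OF inj_on_subset[OF inj_cross_lozenge]])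
      (auto simp: cross_lozenge_def lozenge_weight_horizontal algebra_simps intro!: prod.cong)
  finally show ?thesis by simp
qed

lemma tiling_sum_Suc:
  assumes W: "W \<subseteq> {1..x + y + 1}"
  shows "tiling_sum x (Suc y) W q X Y k =
    (\<Sum>V | interlacing W V.
      (\<Prod>v\<in>V. wt q X Y (2 * int v + k - (int x + int y + 1))) * tiling_sum x y V q X Y k)"
proof -
  have fin: "finite {V. interlacing W V}"
    by (rule finite_subset[of _ "Pow {1..<x + y + 1}"]) (use interlacing_subset[OF _ W] in auto)
  have "tiling_sum x (Suc y) W q X Y k =
      (\<Sum>(V, T)\<in>(SIGMA V:{V. interlacing W V}. tilings x y V).
        \<Prod>l\<in>extend_tiling x y W V T. lozenge_weight x q X Y k l)"
    unfolding tiling_sum_def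
    by (subst sum.reindex_bij_betw[OF bij_betw_extend_tiling[OF W], symmetric])
      (simp add: case_prod_unfold)
  also have "\<dots> = (\<Sum>(V, T)\<in>(SIGMA V:{V. interlacing W V}. tilings x y V).
      (\<Prod>v\<in>V. wt q X Y (2 * int v + k - (int x + int y + 1))) *
      (\<Prod>l\<in>T. lozenge_weight x q X Y k l))"
    by (rule sum.cong) (auto simp: prod_lozenge_weight_extend_tiling[OF W])
  also have "\<dots> = (\<Sum>V | interlacing W V.
      (\<Prod>v\<in>V. wt q X Y (2 * int v + k - (int x + int y + 1))) * tiling_sum x y V q X Y k)"
    unfolding tiling_sum_def sum_distrib_left
    using fin finite_tilings by (intro sum.Sigma[symmetric]) auto
  finally show ?thesis .
qed

text \<open>Each strip accounts for one dent, as interlacing sets differ by one in size.\<close>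

lemma card_if_tilings_nonempty:
  assumes "W \<subseteq> {1..x + y}" "T \<in> tilings x y W"
  shows "card W = y"
  using assms
proof (induction y arbitrary: W T)
  case 0
  then show ?case by (auto simp: tilings_def trapezoid_0 dents_def)
next
  case (Suc y)
  then have W: "W \<subseteq> {1..x + y + 1}" by simp
  obtain V T' where int: "interlacing W V" and "T' \<in> tilings x y V"
    using tilings_Suc_decompose[OF W Suc.prems(2)] by blast
  moreover have "V \<subseteq> {1..x + y}"
    using interlacing_subset[OF int W] by auto
  ultimately show ?case using Suc.IH by (auto simp: interlacing_def)
qed

section \<open>Determinants\<close>

text \<open>The matrix is the Vandermonde matrix times the matrix of coefficients, and the degree
  bounds make the latter upper triangular.\<close>

lemma det_poly_mat:
  fixes z :: "nat \<Rightarrow> 'a::comm_ring_1"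
  assumes deg: "\<And>j. j < n \<Longrightarrow> degree (p j) \<le> j"
  shows "det (mat n n (\<lambda>(i, j). poly (p j) (z i))) =
    (\<Prod>j<n. coeff (p j) j) * det (mat n n (\<lambda>(i, j). z i ^ j))"
proof -
  let ?C = "mat n n (\<lambda>(m, j). coeff (p j) m)" and ?V = "mat n n (\<lambda>(i, j). z i ^ j)"
  have "mat n n (\<lambda>(i, j). poly (p j) (z i)) = ?V * ?C"
  proof (rule eq_matI)
    fix i j assume "i < dim_row (?V * ?C)" "j < dim_col (?V * ?C)"
    then have ij: "i < n" "j < n" by simp_all
    have "poly (p j) (z i) = (\<Sum>m\<le>degree (p j). coeff (p j) m * z i ^ m)"
      by (rule poly_altdef)
    also have "\<dots> = (\<Sum>m = 0..<n. coeff (p j) m * z i ^ m)"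
      using deg[OF ij(2)] ij by (intro sum.mono_neutral_left) (auto simp: coeff_eq_0)
    finally show "mat n n (\<lambda>(i, j). poly (p j) (z i)) $$ (i, j) = (?V * ?C) $$ (i, j)"
      using ij by (simp add: scalar_prod_def mult.commute)
  qed simp_all
  moreover have "det ?C = (\<Prod>j<n. coeff (p j) j)"
  proof -
    have "coeff (p j) m = 0" if "j < m" "m < n" for j m
      using that deg[of j] by (intro coeff_eq_0) auto
    then have "det ?C = prod_list (diag_mat ?C)"
      by (intro det_upper_triangular[of _ n]) auto
    then show ?thesis
      by (simp add: prod_list_diag_prod atLeast0LessThan)
  qed
  ultimately show ?thesis
    by (simp add: det_mult[of _ n] mult.commute)
qed

text \<open>The powers may be replaced by the Newton polynomials, monic and vanishing at all earlier
  nodes, which makes the matrix triangular.\<close>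

lemma det_vandermonde:
  fixes z :: "nat \<Rightarrow> 'a::comm_ring_1"
  shows "det (mat n n (\<lambda>(i, j). z i ^ j)) = (\<Prod>j<n. \<Prod>i<j. z j - z i)"
proof -
  let ?p = "\<lambda>j. \<Prod>i<j. [:- z i, 1:]"
  have p: "degree (?p j) \<le> j \<and> coeff (?p j) j = 1" for j
  proof (induction j)
    case (Suc j)
    have *: "?p (Suc j) = pCons 0 (?p j) - smult (z j) (?p j)"
      by simp
    have "degree (?p (Suc j)) \<le> Suc j" unfolding *
      using Suc by (intro degree_diff_le) (auto intro: order_trans[OF degree_smult_le])
    moreover have "coeff (?p (Suc j)) (Suc j) = 1"
      unfolding * using Suc by (simp add: coeff_eq_0)
    ultimately show ?case by blast
  qed simp
  let ?N = "mat n n (\<lambda>(i, j). poly (?p j) (z i))"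
  have "poly (?p j) (z i) = 0" if "i < j" for i j
    using that by (auto simp: poly_prod intro!: prod_zero)
  then have "det ?N = prod_list (diag_mat ?N)"
    by (intro det_lower_triangular[of n]) auto
  then have "det ?N = (\<Prod>j<n. \<Prod>i<j. z j - z i)"
    by (simp add: prod_list_diag_prod atLeast0LessThan poly_prod)
  moreover have "det ?N = det (mat n n (\<lambda>(i, j). z i ^ j))"
    using p by (subst det_poly_mat) simp_all
  ultimately show ?thesis by simp
qed

text \<open>Subtracting from each row its predecessor, which is left multiplication by the unipotent
  \<open>?L\<close>, reduces the first column to its top entry 1.\<close>

lemma det_vandermonde_differences:
  fixes z :: "nat \<Rightarrow> 'a::comm_ring_1"
  shows "det (mat (Suc n) (Suc n) (\<lambda>(i, j). z i ^ j)) =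
    det (mat n n (\<lambda>(i, j). z (Suc i) ^ Suc j - z i ^ Suc j))"
proof -
  let ?V = "mat (Suc n) (Suc n) (\<lambda>(i, j). z i ^ j)"
  let ?L = "mat (Suc n) (Suc n) (\<lambda>(i, l). if l = i then 1 else if Suc l = i then - 1 else 0 :: 'a)"
  let ?D = "mat n n (\<lambda>(i, j). z (Suc i) ^ Suc j - z i ^ Suc j)"
  let ?B = "four_block_mat (1\<^sub>m 1) (mat 1 n (\<lambda>(i, j). z 0 ^ Suc j)) (0\<^sub>m n 1) ?D"
  have L: "det ?L = 1"
    by (subst det_lower_triangular[of "Suc n"]) (auto simp: prod_list_diag_prod)
  have "?L * ?V = ?B"
  proof (rule eq_matI)
    fix i j assume "i < dim_row ?B" "j < dim_col ?B"
    then have ij: "i < Suc n" "j < Suc n" by simp_all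
    have "(?L * ?V) $$ (i, j) =
        (\<Sum>l = 0..<Suc n. (if l = i then 1 else if Suc l = i then - 1 else 0) * z l ^ j)"
      using ij by (simp add: scalar_prod_def)
    also have "\<dots> = (\<Sum>l = 0..<Suc n. (if l = i then z l ^ j else 0) -
        (if Suc l = i then z l ^ j else 0))"
      by (intro sum.cong) auto
    also have "\<dots> = z i ^ j - (\<Sum>l = 0..<Suc n. if Suc l = i then z l ^ j else 0)"
      using ij by (simp add: sum_subtractf del: sum.op_ivl_Suc)
    also have "(\<Sum>l = 0..<Suc n. if Suc l = i then z l ^ j else 0) =
        (if i = 0 then 0 else z (i - 1) ^ j)"
      using ij by (cases i) (simp_all del: sum.op_ivl_Suc)
    also have "z i ^ j - (if i = 0 then 0 else z (i - 1) ^ j) = ?B $$ (i, j)"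
      using ij by (cases i; cases j) auto
    finally show "(?L * ?V) $$ (i, j) = ?B $$ (i, j)" .
  qed simp_all
  then have "det ?V = det ?B"
    using L det_mult[of ?L "Suc n" ?V] by simp
  also have "\<dots> = det ?D"
    by (subst det_four_block_mat_lower_left_zero_col[where n = n]) simp_all
  finally show ?thesis .
qed

text \<open>Row \<open>i\<close> depends on \<open>b i\<close> only, so by multilinearity the sum
  over all choices moves into the rows. The Leibniz expansion makes this a product of sums for each
  permutation.\<close>

lemma sum_PiE_det:
  fixes p :: "nat \<Rightarrow> 'b \<Rightarrow> 'a::comm_ring_1"
  assumes "\<And>i. finite (I i)"
  shows "(\<Sum>b\<in>PiE {..<n} I. (\<Prod>i<n. g (b i)) * det (mat n n (\<lambda>(i, j). p j (b i)))) =
    det (mat n n (\<lambda>(i, j). \<Sum>v\<in>I i. g v * p j v))"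
proof -
  have perm: "\<sigma> i < n" if "\<sigma> permutes {..<n}" "i < n" for \<sigma> i
    using permutes_in_image[OF that(1), of i] that(2) by simp
  have det: "det (mat n n (\<lambda>(i, j). f i j)) =
      (\<Sum>\<sigma> | \<sigma> permutes {..<n}. signof \<sigma> * (\<Prod>i<n. f i (\<sigma> i)))" for f :: "nat \<Rightarrow> nat \<Rightarrow> 'a"
    by (subst det_def'[of _ n])
      (auto simp: atLeast0LessThan perm intro!: sum.cong prod.cong)
  have "(\<Sum>b\<in>PiE {..<n} I. (\<Prod>i<n. g (b i)) * det (mat n n (\<lambda>(i, j). p j (b i)))) =
    (\<Sum>b\<in>PiE {..<n} I. \<Sum>\<sigma> | \<sigma> permutes {..<n}.
      signof \<sigma> * (\<Prod>i<n. g (b i) * p (\<sigma> i) (b i)))"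
    by (simp add: det sum_distrib_left prod.distrib mult.left_commute)
  also have "\<dots> = (\<Sum>\<sigma> | \<sigma> permutes {..<n}.
      signof \<sigma> * (\<Sum>b\<in>PiE {..<n} I. \<Prod>i<n. g (b i) * p (\<sigma> i) (b i)))"
    by (subst sum.swap) (simp add: sum_distrib_left)
  also have "\<dots> = (\<Sum>\<sigma> | \<sigma> permutes {..<n}.
      signof \<sigma> * (\<Prod>i<n. \<Sum>v\<in>I i. g v * p (\<sigma> i) v))"
    using assms by (simp add: prod_sum_PiE)
  also have "\<dots> = det (mat n n (\<lambda>(i, j). \<Sum>v\<in>I i. g v * p j v))"
    by (simp add: det)
  finally show ?thesis .
qed

section \<open>Telescoping the product formula\<close>

text \<open>
  \<open>(a\<^sup>j\<^sup>+\<^sup>1 - b\<^sup>j\<^sup>+\<^sup>1) / (a - b)\<close> as a polynomial in \<open>t\<close>, where \<open>a + b = s t\<close> and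
  \<open>a b = t\<^sup>2 - c\<close>.
\<close>

fun divided_power :: "'a::comm_ring_1 \<Rightarrow> 'a \<Rightarrow> nat \<Rightarrow> 'a poly" where
  "divided_power s c 0 = 1"
| "divided_power s c (Suc 0) = [:0, s:]"
| "divided_power s c (Suc (Suc j)) =
    [:0, s:] * divided_power s c (Suc j) - [:- c, 0, 1:] * divided_power s c j"

text \<open>Differences of powers obey the linear recurrence with characteristic roots
  \<open>a\<close> and \<open>b\<close>. Keeping the factor \<open>a - b\<close> on the left covers
  \<open>a = b\<close> too.\<close>

lemma poly_divided_power:
  assumes sum: "a + b = s * t" and prod: "a * b = t\<^sup>2 - c"
  shows "(a - b) * poly (divided_power s c j) t = a ^ Suc j - b ^ Suc j"
proof (induction j rule: less_induct)
  case (less j)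
  consider "j = 0" | "j = 1" | m where "j = Suc (Suc m)"
    by (metis One_nat_def not0_implies_Suc)
  then show ?case
  proof cases
    case 2
    have "(a - b) * (t * s) = (a - b) * (a + b)"
      by (simp add: sum mult.commute)
    with 2 show ?thesis by (simp add: algebra_simps)
  next
    case 3
    have "(a - b) * poly (divided_power s c j) t =
        (s * t) * ((a - b) * poly (divided_power s c (Suc m)) t) -
        (t\<^sup>2 - c) * ((a - b) * poly (divided_power s c m) t)"
      by (simp add: 3 algebra_simps power2_eq_square)
    also have "\<dots> = (a + b) * (a ^ Suc (Suc m) - b ^ Suc (Suc m)) - (a * b) * (a ^ Suc m - b ^ Suc m)"
      using less[of m] less[of "Suc m"] 3 by (simp add: sum prod)
    also have "\<dots> = a ^ Suc j - b ^ Suc j"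
      by (simp add: 3 algebra_simps)
    finally show ?thesis .
  qed simp
qed

lemma degree_divided_power: "degree (divided_power s c j) \<le> j"
proof (induction j rule: less_induct)
  case (less j)
  consider "j = 0" | "j = 1" | m where "j = Suc (Suc m)"
    by (metis One_nat_def not0_implies_Suc)
  then show ?case
  proof cases
    case 3
    have "degree ([:0, s:] * divided_power s c (Suc m)) \<le> Suc (Suc m)"
      using less[of "Suc m"] degree_mult_le[of "[:0, s:]" "divided_power s c (Suc m)"] 3
      by (simp split: if_splits)
    moreover have "degree ([:- c, 0, 1:] * divided_power s c m) \<le> Suc (Suc m)"
      using less[of m] degree_mult_le[of "[:- c, 0, 1:]" "divided_power s c m"] 3
      by (simp split: if_splits)
    ultimately show ?thesis
      unfolding 3 divided_power.simps by (rule degree_diff_le)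
  qed simp_all
qed

lemma q_bracket_Suc_Suc:
  fixes q :: "'a::field"
  assumes "q \<noteq> 0"
  shows "q_bracket q (n + 2) = (q + inverse q) * q_bracket q (n + 1) - q_bracket q n"
proof -
  have "q powi (n + 2) - q powi (- (n + 2)) =
      (q + inverse q) * (q powi (n + 1) - q powi (- (n + 1))) - (q powi n - q powi (- n))"
    unfolding power_int_minus using assms by (simp add: power_int_add field_simps power2_eq_square)
  then show ?thesis
    by (simp add: q_bracket_def diff_divide_distrib [symmetric])
qed

text \<open>The leading coefficients obey the recurrence \<open>q_bracket_Suc_Suc\<close> of the
  q-integers; \<open>c\<close> enters only in lower degrees.\<close>

lemma coeff_divided_power:
  fixes q :: "'a::field"
  assumes q: "q \<noteq> 0" "q - inverse q \<noteq> 0"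
  shows "coeff (divided_power (q + inverse q) c j) j = q_bracket q (int (Suc j))"
proof (induction j rule: less_induct)
  case (less j)
  have 1: "q_bracket q 1 = 1"
    using q by (simp add: q_bracket_def power_int_minus)
  consider "j = 0" | "j = 1" | m where "j = Suc (Suc m)"
    by (metis One_nat_def not0_implies_Suc)
  then show ?case
  proof cases
    case 2
    have "q_bracket q 2 = q + inverse q"
      using q_bracket_Suc_Suc[OF q(1), of 0] 1 by (simp add: q_bracket_def)
    with 2 show ?thesis by simp
  next
    case 3
    have "coeff (divided_power (q + inverse q) c j) j =
        (q + inverse q) * coeff (divided_power (q + inverse q) c (Suc m)) (Suc m) -
        coeff (divided_power (q + inverse q) c m) m"
      using degree_divided_power[of "q + inverse q" c m]
      by (simp add: 3 coeff_eq_0)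
    then show ?thesis
      using less[of m] less[of "Suc m"] 3 q_bracket_Suc_Suc[OF q(1), of "int (Suc m)"]
      by (simp add: add.commute)
  qed (simp add: 1)
qed

section \<open>Products as Vandermonde determinants\<close>

definition alternant_var :: "'a::field \<Rightarrow> 'a \<Rightarrow> 'a \<Rightarrow> int \<Rightarrow> 'a" where
  "alternant_var q X Y m = X * q powi m - Y * q powi (- m)"

text \<open>These are the two hypotheses of \<open>poly_divided_power\<close>, with
  \<open>s = q + inverse q\<close> and a \<open>c\<close> that does not depend on
  \<open>m\<close>.\<close>

lemma alternant_var_neighbours:
  fixes q :: "'a::field"
  assumes "q \<noteq> 0"
  shows "alternant_var q X Y (m + 1) + alternant_var q X Y (m - 1) =
      (q + inverse q) * alternant_var q X Y m"
    and "alternant_var q X Y (m + 1) * alternant_var q X Y (m - 1) =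
      (alternant_var q X Y m)\<^sup>2 - X * Y * (q - inverse q)\<^sup>2"
  using assms
  by (simp_all add: alternant_var_def power_int_add power_int_diff power_int_minus field_simps
      power2_eq_square)

text \<open>Serves twice: for the factors of \<open>Delta11\<close>, with \<open>n\<close> the
  difference of two labels, and for the weight of one lozenge, with \<open>n = 1\<close>.\<close>

lemma wt_mult_q_bracket:
  fixes q :: "'a::field"
  assumes "(2::'a) \<noteq> 0" "q \<noteq> 0" "q - inverse q \<noteq> 0"
  shows "2 * (q - inverse q) * (wt q X Y m * q_bracket q n) =
    alternant_var q X Y (m + n) - alternant_var q X Y (m - n)"
proof -
  have "2 * (q - inverse q) * (wt q X Y m * q_bracket q n) =
      (2 * wt q X Y m) * ((q - inverse q) * q_bracket q n)" by simp
  also have "(q - inverse q) * q_bracket q n = q powi n - q powi (- n)"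
    using assms by (simp add: q_bracket_def)
  also have "2 * wt q X Y m = X * q powi m + Y * q powi (- m)"
    using assms by (simp add: wt_def)
  also have "(X * q powi m + Y * q powi (- m)) * (q powi n - q powi (- n)) =
      alternant_var q X Y (m + n) - alternant_var q X Y (m - n)"
    using assms
    by (simp add: alternant_var_def power_int_add power_int_diff power_int_minus field_simps)
  finally show ?thesis .
qed

lemma prod_pairs_image:
  fixes b :: "nat \<Rightarrow> nat"
  assumes b: "strict_mono_on {..<n} b"
  shows "(\<Prod>(v, w)\<in>{(v, w). v \<in> b ` {..<n} \<and> w \<in> b ` {..<n} \<and> v < w}. g v w) =
    (\<Prod>j<n. \<Prod>i<j. g (b i) (b j))"
proof -
  have less: "b i < b j \<longleftrightarrow> i < j" if "i < n" "j < n" for i j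
    using strict_mono_on_less[OF b, of i j] that by simp
  have eq: "b i = b j \<longleftrightarrow> i = j" if "i < n" "j < n" for i j
    using strict_mono_on_eqD[OF b, of i j] that by auto
  have "(\<Prod>j<n. \<Prod>i<j. g (b i) (b j)) = (\<Prod>(j, i)\<in>Sigma {..<n} lessThan. g (b i) (b j))"
    by (rule prod.Sigma) auto
  also have "\<dots> = (\<Prod>(v, w)\<in>(\<lambda>(j, i). (b i, b j)) ` Sigma {..<n} lessThan. g v w)"
    by (subst prod.reindex) (auto simp: inj_on_def eq intro!: prod.cong)
  also have "(\<lambda>(j, i). (b i, b j)) ` Sigma {..<n} lessThan =
      {(v, w). v \<in> b ` {..<n} \<and> w \<in> b ` {..<n} \<and> v < w}"
    by (auto simp: less image_iff)
  finally show ?thesis by simp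
qed

text \<open>\<open>v + w\<close> plus or minus \<open>w - v\<close> is \<open>2 * w\<close> or
  \<open>2 * v\<close>, so each factor of \<open>Delta11\<close> is a difference of nodes. There are
  \<open>j\<close> pairs with larger index \<open>j\<close>, whence the power
  \<open>j\<close>.\<close>

lemma Delta11_eq_det:
  fixes q X Y :: "'a::field"
  assumes q: "(2::'a) \<noteq> 0" "q \<noteq> 0" "q - inverse q \<noteq> 0" and b: "strict_mono_on {..<n} b"
  shows "(\<Prod>j<n. (2 * (q - inverse q)) ^ j) * Delta11 x n q X Y k (b ` {..<n}) =
    det (mat n n (\<lambda>(i, j). alternant_var q X Y (2 * int (b i) + k - (int x + int n + 1)) ^ j))"
proof -
  let ?g = "\<lambda>v w. wt q X Y ((int v + int w + k) - (int x + int n + 1)) * q_bracket q (int w - int v)"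
  have g: "2 * (q - inverse q) * ?g v w = alternant_var q X Y (2 * int w + k - (int x + int n + 1)) -
      alternant_var q X Y (2 * int v + k - (int x + int n + 1))" for v w :: nat
    by (subst wt_mult_q_bracket[OF q]) (simp add: algebra_simps)
  have "Delta11 x n q X Y k (b ` {..<n}) = (\<Prod>j<n. \<Prod>i<j. ?g (b i) (b j))"
    unfolding Delta11_def by (rule prod_pairs_image[OF b])
  then have "(\<Prod>j<n. (2 * (q - inverse q)) ^ j) * Delta11 x n q X Y k (b ` {..<n}) =
      (\<Prod>j<n. \<Prod>i<j. 2 * (q - inverse q) * ?g (b i) (b j))"
    by (simp add: prod.distrib power_mult_distrib)
  then show ?thesis
    by (simp only: g det_vandermonde)
qed

text \<open>\<open>q_fact q n\<close> is the product of the leading coefficients of the divided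
  powers. It converts the Vandermonde determinant into one whose entries, times the weights, are
  differences that telescope over each gap of \<open>a\<close>.\<close>

lemma sum_Delta11_interlacing:
  fixes q X Y :: "'a::field"
  assumes q: "(2::'a) \<noteq> 0" "q \<noteq> 0" "q - inverse q \<noteq> 0" and a: "strict_mono_on {..<Suc n} a"
  shows "q_fact q n * (\<Sum>b\<in>PiE {..<n} (\<lambda>i. {a i..<a (Suc i)}).
      (\<Prod>v\<in>b ` {..<n}. wt q X Y (2 * int v + k - (int x + int n + 1))) *
      Delta11 x n q X Y k (b ` {..<n})) =
    Delta11 x (Suc n) q X Y k (a ` {..<Suc n})"
    (is "_ * ?sum = _")
proof -
  let ?B = "PiE {..<n} (\<lambda>i. {a i..<a (Suc i)})"
  let ?c = "2 * (q - inverse q)" and ?f = "alternant_var q X Y"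
  let ?m = "\<lambda>v. 2 * int v + k - (int x + int n + 1)"
  let ?P = "divided_power (q + inverse q) (X * Y * (q - inverse q)\<^sup>2)"
  \<comment> \<open>Nodes of the wider trapezoid, where \<open>n + 1\<close> becomes
    \<open>n + 2\<close>: the exponent \<open>?m v\<close> lies midway between those of
    \<open>z v\<close> and \<open>z (Suc v)\<close>.\<close>
  define z where "z v = ?f (2 * int v + k - (int x + int (Suc n) + 1))" for v
  have c: "?c \<noteq> 0" using q by simp
  have neighbours: "?f (?m v + 1) = z (Suc v)" "?f (?m v - 1) = z v" for v
    by (simp_all add: z_def algebra_simps)
  have summand: "?c * wt q X Y (?m v) * poly (?P j) (?f (?m v)) = z (Suc v) ^ Suc j - z v ^ Suc j"
    for j v
  proof -
    have "?c * wt q X Y (?m v) = z (Suc v) - z v"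
      using wt_mult_q_bracket[OF q, of X Y "?m v" 1] q neighbours[of v]
      by (simp add: q_bracket_def power_int_minus)
    then show ?thesis
      using poly_divided_power[OF alternant_var_neighbours[OF q(2)], of X Y "?m v" j]
      by (simp only: neighbours)
  qed
  have q_fact: "q_fact q n = (\<Prod>j<n. coeff (?P j) j)"
    by (simp add: q_fact_def prod.atLeast1_atMost_eq coeff_divided_power[OF q(2,3)])
  \<comment> \<open>The factor \<open>?c ^ n\<close> is shared out among the \<open>n\<close>
    weights; the factors with \<open>j < n\<close> belong to \<open>Delta11\<close>.\<close>
  have "(\<Prod>j<Suc n. ?c ^ j) * (q_fact q n * ?sum) =
      (\<Sum>b\<in>?B. (\<Prod>i<n. ?c * wt q X Y (?m (b i))) *
        det (mat n n (\<lambda>(i, j). poly (?P j) (?f (?m (b i))))))"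
    unfolding sum_distrib_left
  proof (rule sum.cong[OF refl])
    fix b assume "b \<in> ?B"
    then have b: "strict_mono_on {..<n} b"
      by (rule strict_mono_on_interlacing_choice[OF a])
    have "(\<Prod>v\<in>b ` {..<n}. wt q X Y (?m v)) = (\<Prod>i<n. wt q X Y (?m (b i)))"
      by (simp add: prod.reindex strict_mono_on_imp_inj_on[OF b])
    moreover have "det (mat n n (\<lambda>(i, j). poly (?P j) (?f (?m (b i))))) =
        q_fact q n * ((\<Prod>j<n. ?c ^ j) * Delta11 x n q X Y k (b ` {..<n}))"
      unfolding Delta11_eq_det[OF q b] q_fact
      by (rule det_poly_mat) (rule degree_divided_power)
    ultimately show "(\<Prod>j<Suc n. ?c ^ j) * (q_fact q n * ((\<Prod>v\<in>b ` {..<n}. wt q X Y (?m v)) *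
          Delta11 x n q X Y k (b ` {..<n}))) =
        (\<Prod>i<n. ?c * wt q X Y (?m (b i))) * det (mat n n (\<lambda>(i, j). poly (?P j) (?f (?m (b i)))))"
      by (simp add: prod.distrib mult_ac)
  qed
  also have "\<dots> = det (mat n n (\<lambda>(i, j).
      \<Sum>v\<in>{a i..<a (Suc i)}. ?c * wt q X Y (?m v) * poly (?P j) (?f (?m v))))"
    by (rule sum_PiE_det) simp
  also have "\<dots> = det (mat n n (\<lambda>(i, j). z (a (Suc i)) ^ Suc j - z (a i) ^ Suc j))"
  proof (rule arg_cong[of _ _ det], rule cong_mat)
    fix i j assume "i < n" "j < n"
    then have "a i \<le> a (Suc i)" using strict_mono_on_leD[OF a, of i "Suc i"] by simp
    then show "(\<lambda>(i, j). \<Sum>v\<in>{a i..<a (Suc i)}. ?c * wt q X Y (?m v) * poly (?P j) (?f (?m v))) (i, j) =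
        (\<lambda>(i, j). z (a (Suc i)) ^ Suc j - z (a i) ^ Suc j) (i, j)"
      unfolding summand prod.case by (rule sum_Suc_diff')
  qed simp_all
  also have "\<dots> = (\<Prod>j<Suc n. ?c ^ j) * Delta11 x (Suc n) q X Y k (a ` {..<Suc n})"
    unfolding Delta11_eq_det[OF q a] using det_vandermonde_differences[of n "\<lambda>i. z (a i)"]
    by (simp only: z_def)
  finally have eq: "(\<Prod>j<Suc n. ?c ^ j) * (q_fact q n * ?sum) =
      (\<Prod>j<Suc n. ?c ^ j) * Delta11 x (Suc n) q X Y k (a ` {..<Suc n})" .
  have nz: "(\<Prod>j<Suc n. ?c ^ j) \<noteq> 0"
    using c by (subst prod_zero_iff) auto
  show ?thesis by (rule mult_left_cancel[OF nz, THEN iffD1, OF eq])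
qed

section \<open>Induction on the width\<close>

lemma sum_Delta11:
  fixes q X Y :: "'a::field"
  assumes q: "(2::'a) \<noteq> 0" "q \<noteq> 0" "q - inverse q \<noteq> 0" and W: "finite W" "card W = Suc n"
  shows "q_fact q n * (\<Sum>V | interlacing W V.
      (\<Prod>v\<in>V. wt q X Y (2 * int v + k - (int x + int n + 1))) * Delta11 x n q X Y k V) =
    Delta11 x (Suc n) q X Y k W"
proof -
  have "strict_mono_on {..<Suc n} (enumerate W)"
    using W by (intro strict_mono_onI finite_enumerate_mono) auto
  from sum_Delta11_interlacing[OF q this, where x = x and X = X and Y = Y and k = k]
  show ?thesis
    using finite_bij_enumerate[OF W(1)] W(2) by (simp add: bij_betw_def sum_interlacing[OF W])
qed

text \<open>Passing from \<open>y\<close> to \<open>Suc y\<close> multiplies the denominator by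
  \<open>q_fact q y\<close>, exactly the factor in \<open>sum_Delta11\<close>, so both sides follow
  the same recursion over the strips.\<close>

lemma tiling_sum_eq:
  fixes q X Y :: "'a::field"
  assumes q: "(2::'a) \<noteq> 0" "q \<noteq> 0" "q - inverse q \<noteq> 0"
    and "\<forall>i\<in>{1..<y}. q_bracket q (int i) \<noteq> 0" "W \<subseteq> {1..x + y}" "card W = y"
  shows "(\<Prod>i\<in>{1..<y}. q_fact q i) * tiling_sum x y W q X Y k = Delta11 x y q X Y k W"
  using assms(4-)
proof (induction y arbitrary: W)
  case 0
  then have "W = {}" using finite_subset by fastforce
  moreover have "tilings x 0 {} = {{}}"
    by (auto simp: tilings_def trapezoid_0 dents_def partition_on_empty)
  ultimately show ?case by (simp add: tiling_sum_def Delta11_def)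
next
  case (Suc y)
  then have W: "W \<subseteq> {1..x + y + 1}" "finite W" by (auto intro: finite_subset)
  have V: "V \<subseteq> {1..x + y}" "card V = y" if "interlacing W V" for V
    using interlacing_subset[OF that W(1)] that Suc.prems(3) by (auto simp: interlacing_def)
  \<comment> \<open>For \<open>y = 0\<close> the range on the left is still empty, and
    \<open>q_fact q 0 = 1\<close>.\<close>
  have "(\<Prod>i\<in>{1..<Suc y}. q_fact q i) = q_fact q y * (\<Prod>i\<in>{1..<y}. q_fact q i)"
    by (cases y) (simp_all add: q_fact_def)
  then have "(\<Prod>i\<in>{1..<Suc y}. q_fact q i) * tiling_sum x (Suc y) W q X Y k =
      q_fact q y * (\<Sum>V | interlacing W V. (\<Prod>v\<in>V. wt q X Y (2 * int v + k - (int x + int y + 1))) *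
        ((\<Prod>i\<in>{1..<y}. q_fact q i) * tiling_sum x y V q X Y k))"
    by (simp add: tiling_sum_Suc[OF W(1)] sum_distrib_left mult_ac)
  also have "\<dots> = q_fact q y * (\<Sum>V | interlacing W V.
      (\<Prod>v\<in>V. wt q X Y (2 * int v + k - (int x + int y + 1))) * Delta11 x y q X Y k V)"
    using Suc.IH V Suc.prems(1) by simp
  also have "\<dots> = Delta11 x (Suc y) q X Y k W"
    using sum_Delta11[OF q W(2)] Suc.prems(3) by blast
  finally show ?case .
qed

text \<open>The conditions on \<open>2\<close>, \<open>q\<close> and the brackets make every
  division in the formula legitimate: by \<open>2\<close> in \<open>wt\<close>, by
  \<open>q - inverse q\<close> in \<open>q_bracket\<close>, and by the q-factorials.\<close>

theorem theoremA1:
  fixes x y :: nat and k :: int and W :: "nat set" and q X Y :: "'a::field"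
  assumes "W \<subseteq> {1..x + y}"
  shows "(tilings x y W \<noteq> {} \<longrightarrow> card W = y) \<and>
    (card W = y \<longrightarrow>
      (2::'a) \<noteq> 0 \<longrightarrow> q \<noteq> 0 \<longrightarrow> q\<^sup>2 \<noteq> 1 \<longrightarrow> (\<forall>i\<in>{1..<y}. q_bracket q (int i) \<noteq> 0) \<longrightarrow>
      tiling_sum x y W q X Y k = Delta11 x y q X Y k W / (\<Prod>i\<in>{1..<y}. q_fact q i))"
proof (intro conjI impI)
  assume "tilings x y W \<noteq> {}"
  then show "card W = y" using card_if_tilings_nonempty[OF assms] by blast
next
  assume card: "card W = y" and q: "(2::'a) \<noteq> 0" "q \<noteq> 0" "q\<^sup>2 \<noteq> 1"
    and nz: "\<forall>i\<in>{1..<y}. q_bracket q (int i) \<noteq> 0"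
  have "q - inverse q \<noteq> 0"
    using q by (auto simp: power2_eq_square field_simps)
  then have "(\<Prod>i\<in>{1..<y}. q_fact q i) * tiling_sum x y W q X Y k = Delta11 x y q X Y k W"
    using tiling_sum_eq[OF q(1,2) _ nz assms card] by blast
  moreover have "(\<Prod>i\<in>{1..<y}. q_fact q i) \<noteq> 0"
    using nz by (auto simp: q_fact_def)
  ultimately show "tiling_sum x y W q X Y k = Delta11 x y q X Y k W / (\<Prod>i\<in>{1..<y}. q_fact q i)"
    by (simp add: eq_divide_eq mult.commute)
qed

end
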